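(* Let $\mathbb{F}$ be a field of characteristic $2$, let $n=2r$ with $r\ge 1$ be even, let $m=(m_1,\dots,m_n)$ be a tuple of positive integers with $m\neq(1,1)$ in case $n=2$, and let $H=H(n,m)$ be the Hamiltonian Lie algebra over $\mathbb{F}$. (a) If $n>2$, then $H$ is a simple Lie algebra. (b) If $n=2$, then $H\cong S(2,m)'$ as Lie algebras, where $S(2,m)'$ is the derived subalgebra of the special Lie algebra $S(2,m)$ over $\mathbb{F}$.
   Context: Let $\mathbb{F}$ be a field of characteristic $p>0$ (here $p=2$), $n\ge 1$, and $m=(m_1,\dots,m_n)$ a tuple of positive integers. Put $\tau=(p^{m_1}-1,\dots,p^{m_n}-1)$. The (divided power) algebra $A(n,m)$ is the commutative associative unital $\mathbb{F}$-algebra with $\mathbb{F}$-basis the symbols $X^{(a)}$ (also written $X^a$), where $a=(a_1,\dots,a_n)$ runs over tuples of non-negative integers with $0\le a\le\tau$ componentwise, and multiplication $X^{(a)}X^{(b)}=\binom{a+b}{a}X^{(a+b)}$, where $\binom{a+b}{a}=\prod_{i}\binom{a_i+b_i}{a_i}$ is evaluated modulo $p$ (the product is $0$ when $a+b\not\le\tau$, since then the coefficient vanishes modulo $p$). For $1\le j\le n$, $D_j$ is the partial derivation of $A(n,m)$ in the $j$-th variable: $D_j(X^{(a)})=X^{(a-\varepsilon_j)}$ if $a_j\ge 1$ and $D_j(X^{(a)})=0$ if $a_j=0$, with $\varepsilon_j$ the $j$-th unit vector. The Witt algebra $W(n,m)$ is the Lie algebra $\{\sum_{j=1}^n f_jD_j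 \mid f_j\in A(n,m)\}$ (a free $A(n,m)$-module on $D_1,\dots,D_n$) with bracket $[fD_i,gD_j]=fD_i(g)D_j-gD_j(f)D_i$. Special algebra: for $n>1$ let $\mathrm{div}:W(n,m)\to A(n,m)$, $\sum_{j=1}^n f_jD_j\mapsto\sum_{j=1}^n D_j(f_j)$. The special Lie algebra $S(n,m)$ is the derived subalgebra of the kernel of $\mathrm{div}$. Hamiltonian algebra: let $n=2r\ge 2$ be even. For $1\le j\le r$ put $\sigma(j)=1$ and $j'=j+r$; for $r<j\le n$ put $\sigma(j)=-1$ and $j'=j-r$. Define the linear map $D_H:A(n,m)\to W(n,m)$, $f\mapsto\sum_{j=1}^n\sigma(j)D_j(f)D_{j'}$. Then $H(n,m)$ is the derived subalgebra of the image of $D_H$ (the image is a Lie subalgebra of $W(n,m)$). A Lie algebra is simple if it is non-abelian and has no ideals other than $0$ and itself. *)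

theory Defs
  imports Complex_Main "HOL-Library.Function_Algebras"
begin

text \<open>
  A Lie algebra is a subspace \<open>L\<close> of an ambient vector space, with a bracket whose behaviour
  outside \<open>L\<close> is irrelevant.
\<close>

locale lie_algebra = vector_space scale
  for scale :: "'a::field \<Rightarrow> 'v::ab_group_add \<Rightarrow> 'v" +
  fixes bracket :: "'v \<Rightarrow> 'v \<Rightarrow> 'v"
    and L :: "'v set"
  assumes carrier_subspace: "subspace L"
    and bracket_closed: "\<lbrakk>x \<in> L; y \<in> L\<rbrakk> \<Longrightarrow> bracket x y \<in> L"
    and bracket_add_left:
      "\<lbrakk>x \<in> L; y \<in> L; z \<in> L\<rbrakk> \<Longrightarrow> bracket (x + y) z = bracket x z + bracket y z"
    and bracket_add_right:
      "\<lbrakk>x \<in> L; y \<in> L; z \<in> L\<rbrakk> \<Longrightarrow> bracket x (y + z) = bracket x y + bracket x z"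
    and bracket_scale_left:
      "\<lbrakk>x \<in> L; y \<in> L\<rbrakk> \<Longrightarrow> bracket (scale c x) y = scale c (bracket x y)"
    and bracket_scale_right:
      "\<lbrakk>x \<in> L; y \<in> L\<rbrakk> \<Longrightarrow> bracket x (scale c y) = scale c (bracket x y)"
    and bracket_self: "x \<in> L \<Longrightarrow> bracket x x = 0"
    and jacobi: "\<lbrakk>x \<in> L; y \<in> L; z \<in> L\<rbrakk> \<Longrightarrow>
      bracket x (bracket y z) + bracket y (bracket z x) + bracket z (bracket x y) = 0"

definition lie_ideal ::
    "('a::field \<Rightarrow> 'v::ab_group_add \<Rightarrow> 'v) \<Rightarrow> ('v \<Rightarrow> 'v \<Rightarrow> 'v) \<Rightarrow> 'v set \<Rightarrow> 'v set \<Rightarrow> bool" where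
  "lie_ideal scale bracket L I \<longleftrightarrow>
     module.subspace scale I \<and> I \<subseteq> L \<and> (\<forall>x\<in>L. \<forall>y\<in>I. bracket x y \<in> I)"

locale simple_lie_algebra = lie_algebra +
  assumes nonabelian: "\<exists>x\<in>L. \<exists>y\<in>L. bracket x y \<noteq> 0"
    and ideal_trivial: "lie_ideal scale bracket L I \<Longrightarrow> I = {0} \<or> I = L"

definition derived_subalgebra ::
    "('a::field \<Rightarrow> 'v::ab_group_add \<Rightarrow> 'v) \<Rightarrow> ('v \<Rightarrow> 'v \<Rightarrow> 'v) \<Rightarrow> 'v set \<Rightarrow> 'v set" where
  "derived_subalgebra scale bracket L = module.span scale {bracket x y | x y. x \<in> L \<and> y \<in> L}"

definition lie_isomorphic ::
    "('a::field \<Rightarrow> 'v::ab_group_add \<Rightarrow> 'v) \<Rightarrow> ('v \<Rightarrow> 'v \<Rightarrow> 'v) \<Rightarrow> 'v set \<Rightarrow>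
     ('a \<Rightarrow> 'w::ab_group_add \<Rightarrow> 'w) \<Rightarrow> ('w \<Rightarrow> 'w \<Rightarrow> 'w) \<Rightarrow> 'w set \<Rightarrow> bool" where
  "lie_isomorphic s1 b1 L1 s2 b2 L2 \<longleftrightarrow>
     lie_algebra s1 b1 L1 \<and> lie_algebra s2 b2 L2 \<and>
     (\<exists>\<phi>. bij_betw \<phi> L1 L2 \<and>
        (\<forall>x\<in>L1. \<forall>y\<in>L1. \<phi> (x + y) = \<phi> x + \<phi> y) \<and>
        (\<forall>c. \<forall>x\<in>L1. \<phi> (s1 c x) = s2 c (\<phi> x)) \<and>
        (\<forall>x\<in>L1. \<forall>y\<in>L1. \<phi> (b1 x y) = b2 (\<phi> x) (\<phi> y)))"

text \<open>
  Variables are numbered \<open>1, \<dots>, n\<close>; multi-indices are functions \<open>nat \<Rightarrow> nat\<close> vanishing outside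
  \<open>{1..n}\<close>. An element of \<open>A(n,m)\<close> is its coefficient function, so that \<open>f a\<close> is the coefficient
  of \<open>X\<^sup>(\<^sup>a\<^sup>)\<close> in \<open>f\<close>; it vanishes outside the finite set of admissible multi-indices. The prime
  \<open>p\<close> is the characteristic of the coefficient field. Addition is the pointwise one, but the
  pointwise product of functions plays no role: the product of \<open>A(n,m)\<close> is \<open>dp_mult\<close>.
\<close>

definition dp_indices :: "nat \<Rightarrow> nat \<Rightarrow> (nat \<Rightarrow> nat) \<Rightarrow> (nat \<Rightarrow> nat) set" where
  "dp_indices p n m = {a. (\<forall>i\<in>{1..n}. a i \<le> p ^ m i - 1) \<and> (\<forall>i. i \<notin> {1..n} \<longrightarrow> a i = 0)}"

type_synonym 'a dp = "(nat \<Rightarrow> nat) \<Rightarrow> 'a"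

definition dp_carrier :: "nat \<Rightarrow> (nat \<Rightarrow> nat) \<Rightarrow> 'a::field dp set" where
  "dp_carrier n m = {f. \<forall>a. a \<notin> dp_indices CHAR('a) n m \<longrightarrow> f a = 0}"

definition dp_monom :: "(nat \<Rightarrow> nat) \<Rightarrow> 'a::field dp" where
  "dp_monom a = (\<lambda>b. if b = a then 1 else 0)"

definition multi_binomial :: "nat \<Rightarrow> (nat \<Rightarrow> nat) \<Rightarrow> (nat \<Rightarrow> nat) \<Rightarrow> nat" where
  "multi_binomial n c a = (\<Prod>i\<in>{1..n}. c i choose a i)"

definition dp_mult :: "nat \<Rightarrow> (nat \<Rightarrow> nat) \<Rightarrow> 'a::field dp \<Rightarrow> 'a dp \<Rightarrow> 'a dp" where
  "dp_mult n m f g = (\<lambda>c.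
     if c \<in> dp_indices CHAR('a) n m then
       \<Sum>(a, b) \<in> {(a, b). a \<in> dp_indices CHAR('a) n m \<and> b \<in> dp_indices CHAR('a) n m \<and> a + b = c}.
         of_nat (multi_binomial n (a + b) a) * f a * g b
     else 0)"

text \<open>
  Since \<open>D\<^sub>j\<close> sends \<open>X\<^sup>(\<^sup>b\<^sup>)\<close> to \<open>X\<^sup>(\<^sup>b\<^sup>-\<^sup>\<epsilon>\<^sup>)\<close> with \<open>\<epsilon> = \<epsilon>\<^sub>j\<close> (or to \<open>0\<close>), the coefficient of \<open>D\<^sub>j f\<close>
  at \<open>a\<close> is that of \<open>f\<close> at \<open>a + \<epsilon>\<^sub>j\<close>.
\<close>

definition dp_deriv :: "nat \<Rightarrow> 'a::field dp \<Rightarrow> 'a dp" where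
  "dp_deriv j f = (\<lambda>a. f (a(j := Suc (a j))))"

lemma dp_deriv_monom:
  "dp_deriv j (dp_monom a) = (if a j \<ge> 1 then dp_monom (a(j := a j - 1)) else 0)"
  by (cases "a j \<ge> 1") (auto simp: dp_deriv_def dp_monom_def fun_eq_iff)

lemma finite_dp_indices: "finite (dp_indices p n m)"
proof -
  let ?N = "\<Sum>i\<in>{1..n}. p ^ m i"
  have "a i \<le> ?N" if "a \<in> dp_indices p n m" "i \<in> {1..n}" for a i
  proof -
    have "a i \<le> p ^ m i - 1"
      using that by (simp add: dp_indices_def)
    also have "\<dots> \<le> p ^ m i"
      by (rule diff_le_self)
    also have "\<dots> \<le> ?N"
      using that by (intro member_le_sum) auto
    finally show ?thesis .
  qed
  then have "dp_indices p n m \<subseteq> {a. \<forall>i. (i \<in> {1..n} \<longrightarrow> a i \<in> {..?N}) \<and> (i \<notin> {1..n} \<longrightarrow> a i = 0)}"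
    by (auto simp: dp_indices_def)
  moreover have "finite \<dots>"
    by (rule finite_set_of_finite_funs) auto
  ultimately show ?thesis
    by (rule finite_subset)
qed

lemma dp_mult_monom:
  assumes "a \<in> dp_indices CHAR('a::field) n m" "b \<in> dp_indices CHAR('a) n m"
  shows "dp_mult n m (dp_monom a) (dp_monom b :: 'a dp) =
    (if a + b \<in> dp_indices CHAR('a) n m
     then (\<lambda>c. of_nat (multi_binomial n (a + b) a) * dp_monom (a + b) c) else 0)"
proof
  fix c
  let ?I = "dp_indices CHAR('a) n m"
  let ?S = "{(a', b'). a' \<in> ?I \<and> b' \<in> ?I \<and> a' + b' = c}"
  have fin: "finite ?S"
    by (rule finite_subset[of _ "?I \<times> ?I"]) (auto simp: finite_dp_indices)
  have "(\<Sum>(a', b')\<in>?S. of_nat (multi_binomial n (a' + b') a') * dp_monom a a' * dp_monom b b') =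
      (\<Sum>x\<in>?S. if x = (a, b) then of_nat (multi_binomial n (a + b) a) else (0::'a))"
    by (rule sum.cong) (auto simp: dp_monom_def split: if_splits)
  also have "\<dots> = (if (a, b) \<in> ?S then of_nat (multi_binomial n (a + b) a) else 0)"
    using fin by simp
  finally show "dp_mult n m (dp_monom a) (dp_monom b :: 'a dp) c =
    (if a + b \<in> ?I
     then (\<lambda>c. of_nat (multi_binomial n (a + b) a) * dp_monom (a + b) c) else 0) c"
    using assms unfolding dp_mult_def by (auto simp: dp_monom_def)
qed

text \<open>
  The derivation \<open>f\<^sub>1D\<^sub>1 + \<dots> + f\<^sub>nD\<^sub>n\<close> is the family \<open>v\<close> with \<open>v j = f\<^sub>j\<close> for \<open>j \<in> {1..n}\<close> and
  \<open>v j = 0\<close> otherwise.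
\<close>

type_synonym 'a derivs = "nat \<Rightarrow> 'a dp"

definition witt_scale :: "'a::field \<Rightarrow> 'a derivs \<Rightarrow> 'a derivs" where
  "witt_scale c v = (\<lambda>j a. c * v j a)"

definition witt_carrier :: "nat \<Rightarrow> (nat \<Rightarrow> nat) \<Rightarrow> 'a::field derivs set" where
  "witt_carrier n m = {v. (\<forall>j\<in>{1..n}. v j \<in> dp_carrier n m) \<and> (\<forall>j. j \<notin> {1..n} \<longrightarrow> v j = 0)}"

definition witt_single :: "nat \<Rightarrow> 'a::field dp \<Rightarrow> 'a derivs" where
  "witt_single j f = (\<lambda>k. if k = j then f else 0)"

text \<open>
  The bilinear extension of \<open>[fD\<^sub>i, gD\<^sub>j] = fD\<^sub>i(g)D\<^sub>j - gD\<^sub>j(f)D\<^sub>i\<close>, read off in the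
  \<open>k\<close>-th component; see \<open>witt_bracket_single\<close>.
\<close>

definition witt_bracket ::
    "nat \<Rightarrow> (nat \<Rightarrow> nat) \<Rightarrow> 'a::field derivs \<Rightarrow> 'a derivs \<Rightarrow> 'a derivs" where
  "witt_bracket n m v w = (\<lambda>k. \<Sum>i\<in>{1..n}.
     dp_mult n m (v i) (dp_deriv i (w k)) - dp_mult n m (w i) (dp_deriv i (v k)))"

lemma dp_deriv_0 [simp]: "dp_deriv j 0 = 0"
  by (simp add: dp_deriv_def fun_eq_iff)

lemma dp_mult_0 [simp]: "dp_mult n m 0 g = 0" "dp_mult n m f 0 = 0"
  by (auto simp: dp_mult_def fun_eq_iff)

lemma witt_bracket_single:
  assumes "i \<in> {1..n}" "j \<in> {1..n}"
  shows "witt_bracket n m (witt_single i f) (witt_single j g) =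
    witt_single j (dp_mult n m f (dp_deriv i g)) - witt_single i (dp_mult n m g (dp_deriv j f))"
proof
  fix k
  have *: "(\<Sum>l\<in>{1..n}. dp_mult n m (witt_single l' f' l) (dp_deriv l h)) =
      dp_mult n m f' (dp_deriv l' h)" if "l' \<in> {1..n}" for l' and f' h :: "'a dp"
  proof -
    have "(\<Sum>l\<in>{1..n}. dp_mult n m (witt_single l' f' l) (dp_deriv l h)) =
        (\<Sum>l\<in>{1..n}. if l = l' then dp_mult n m f' (dp_deriv l' h) else 0)"
      by (rule sum.cong) (auto simp: witt_single_def)
    then show ?thesis using that by simp
  qed
  show "witt_bracket n m (witt_single i f) (witt_single j g) k =
    (witt_single j (dp_mult n m f (dp_deriv i g)) - witt_single i (dp_mult n m g (dp_deriv j f))) k"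
    unfolding witt_bracket_def sum_subtractf *[OF assms(1)] *[OF assms(2)]
    by (simp add: witt_single_def)
qed

definition witt_div :: "nat \<Rightarrow> 'a::field derivs \<Rightarrow> 'a dp" where
  "witt_div n v = (\<Sum>j\<in>{1..n}. dp_deriv j (v j))"

definition special_algebra :: "nat \<Rightarrow> (nat \<Rightarrow> nat) \<Rightarrow> 'a::field derivs set" where
  "special_algebra n m =
     derived_subalgebra witt_scale (witt_bracket n m) {v \<in> witt_carrier n m. witt_div n v = 0}"

definition ham_sign :: "nat \<Rightarrow> nat \<Rightarrow> 'a::field" where
  "ham_sign r j = (if j \<le> r then 1 else - 1)"

definition ham_dual :: "nat \<Rightarrow> nat \<Rightarrow> nat" where
  "ham_dual r j = (if j \<le> r then j + r else j - r)"

definition ham_field :: "nat \<Rightarrow> 'a::field dp \<Rightarrow> 'a derivs" where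
  "ham_field n f = (\<Sum>j\<in>{1..n}.
     witt_scale (ham_sign (n div 2) j) (witt_single (ham_dual (n div 2) j) (dp_deriv j f)))"

definition hamiltonian_algebra :: "nat \<Rightarrow> (nat \<Rightarrow> nat) \<Rightarrow> 'a::field derivs set" where
  "hamiltonian_algebra n m =
     derived_subalgebra witt_scale (witt_bracket n m) (ham_field n ` dp_carrier n m)"

end

theory Submission
  imports Defs "HOL-Computational_Algebra.Primes"
begin

text \<open>
  In characteristic 2 all signs disappear, and \<open>[D\<^sub>H f, D\<^sub>H g] = D\<^sub>H {f, g}\<close> for the Poisson bracket
  \<open>{f, g} = \<Sum>\<^sub>i D\<^sub>i\<^sub>' f D\<^sub>i g\<close>. This bracket never has a component at the top monomial \<open>X\<^sup>\<tau>\<close>, while every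
  other monomial is \<open>D\<^sub>j X\<^sup>b = {X\<^sup>b, x\<^sub>j\<^sub>'}\<close> for some \<open>j\<close> and \<open>b\<close>; so \<open>H\<close> consists of the \<open>D\<^sub>H f\<close> where \<open>f\<close> has
  no component at \<open>X\<^sup>\<tau>\<close>.

  For \<open>n = 2\<close>, divergence-free \<open>v, w\<close> satisfy \<open>[v, w] = D\<^sub>H (v\<^sub>1 w\<^sub>2 + v\<^sub>2 w\<^sub>1)\<close>, and in this way
  \<open>X\<^sup>\<tau>\<close> is reached too: it is the product of the top divided powers \<open>g\<close> of \<open>x\<^sub>2\<close> and \<open>f\<close> of \<open>x\<^sub>1\<close>, and the
  fields \<open>gD\<^sub>1\<close> and \<open>fD\<^sub>2\<close> are divergence-free. Hence \<open>S(2,m)\<close> is the whole image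
  of \<open>D\<^sub>H\<close>, and \<open>S(2,m)'\<close> is equal to \<open>H\<close>.

  For \<open>n > 2\<close>, repeated differentiation produces a nonconstant linear element in a nonzero ideal.
  Bracketing it with products \<open>x\<^sub>s x\<^sub>t\<close> isolates every variable, the variables yield all \<open>D\<^sub>j f\<close>, and
  the monomials one step below \<open>X\<^sup>\<tau>\<close> arise as brackets with products of two variables.
\<close>

section \<open>Divided powers\<close>

lemma sum_fun_apply: "(\<Sum>i\<in>A. F i) x = (\<Sum>i\<in>A. F i x)"
  by (induction A rule: infinite_finite_induct) simp_all

text \<open>Both parts of a splitting are bounded by the total degree of \<open>c\<close>.
  Finiteness matters because a \<open>sum\<close> over an infinite set is 0 by convention and could
  not be split.\<close>

lemma finite_sum_splits:
  fixes c :: "nat \<Rightarrow> nat"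
  assumes "\<And>i. i \<notin> {1..n} \<Longrightarrow> c i = 0"
  shows "finite {(a, b). a + b = c}"
proof -
  let ?B = "{a. \<forall>i. (i \<in> {1..n} \<longrightarrow> a i \<in> {..\<Sum>k\<in>{1..n}. c k}) \<and> (i \<notin> {1..n} \<longrightarrow> a i = (0::nat))}"
  have "{(a, b). a + b = c} \<subseteq> ?B \<times> ?B"
  proof (clarify, intro conjI CollectI allI impI)
    fix a b :: "nat \<Rightarrow> nat" and i
    assume c: "c = a + b"
    have "a i \<le> c i" "b i \<le> c i" by (simp_all add: c)
    moreover have "c i \<le> (\<Sum>k\<in>{1..n}. c k)" if "i \<in> {1..n}"
      using that by (intro member_le_sum) auto
    ultimately show "i \<in> {1..n} \<Longrightarrow> a i \<in> {..\<Sum>k\<in>{1..n}. (a + b) k}" "i \<in> {1..n} \<Longrightarrow> b i \<in> {..\<Sum>k\<in>{1..n}. (a + b) k}"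
      unfolding c by (metis atMost_iff order_trans)+
    show "i \<notin> {1..n} \<Longrightarrow> a i = 0" "i \<notin> {1..n} \<Longrightarrow> b i = 0"
      using assms[of i] c by auto
  qed
  moreover have "finite ?B"
    by (rule finite_set_of_finite_funs) auto
  ultimately show ?thesis
    by (meson finite_SigmaI finite_subset)
qed

lemma dp_indices_le:
  assumes "c \<in> dp_indices p n m" and le: "\<And>i. a i \<le> c i"
  shows "a \<in> dp_indices p n m"
proof -
  have "a i \<le> p ^ m i - 1" if "i \<in> {1..n}" for i
    using assms(1) le[of i] that unfolding dp_indices_def by (auto intro: order_trans)
  moreover have "a i = 0" if "i \<notin> {1..n}" for i
    using assms(1) le[of i] that unfolding dp_indices_def by auto
  ultimately show ?thesis by (simp add: dp_indices_def)
qed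

lemma dp_indices_add:
  "a + b \<in> dp_indices p n m \<Longrightarrow> a \<in> dp_indices p n m \<and> b \<in> dp_indices p n m"
  by (auto intro!: dp_indices_le[of "a + b"])

lemma finite_splits_dp_indices:
  "c \<in> dp_indices p n m \<Longrightarrow> finite {(a, b). a + b = c}"
  by (rule finite_sum_splits[of n]) (auto simp: dp_indices_def)

text \<open>Parts of an admissible index are admissible, so the restriction in the definition of
  \<open>dp_mult\<close> disappears and a plain convolution remains.\<close>

lemma dp_mult_apply:
  fixes f g :: "'a::field dp"
  assumes "c \<in> dp_indices CHAR('a) n m"
  shows "dp_mult n m f g c =
    (\<Sum>(a, b)\<in>{(a, b). a + b = c}. of_nat (multi_binomial n c a) * f a * g b)"
proof -
  have "{(a, b). a \<in> dp_indices CHAR('a) n m \<and> b \<in> dp_indices CHAR('a) n m \<and> a + b = c} =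
      {(a, b). a + b = c}"
    using assms dp_indices_add by blast
  then show ?thesis
    using assms unfolding dp_mult_def by (auto intro!: sum.cong)
qed

lemma dp_mult_outside:
  "c \<notin> dp_indices CHAR('a) n m \<Longrightarrow> dp_mult n m f (g :: 'a::field dp) c = 0"
  by (simp add: dp_mult_def)

section \<open>Commutativity and associativity of the divided power product\<close>

lemma multi_binomial_sym: "multi_binomial n (a + b) a = multi_binomial n (a + b) b"
  unfolding multi_binomial_def
  by (intro prod.cong refl, subst binomial_symmetric) auto

text \<open>Both sides are the multinomial coefficient (a+b+e)! / (a! b! e!), taken
  componentwise.\<close>

lemma multi_binomial_assoc:
  "multi_binomial n (a + b + e) (a + b) * multi_binomial n (a + b) a =
   multi_binomial n (a + b + e) a * multi_binomial n (b + e) b"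
  unfolding multi_binomial_def prod.distrib[symmetric]
proof (intro prod.cong refl)
  fix i
  show "((a + b + e) i choose (a + b) i) * ((a + b) i choose a i) =
      ((a + b + e) i choose a i) * ((b + e) i choose b i)"
    using choose_mult[of "a i" "a i + b i" "a i + b i + e i"] by (simp add: add.assoc)
qed

lemma dp_mult_commute: "dp_mult n m f g = dp_mult n m g (f :: 'a::field dp)"
proof
  fix c
  show "dp_mult n m f g c = dp_mult n m g f c"
  proof (cases "c \<in> dp_indices CHAR('a) n m")
    case True
    have "(\<Sum>(a, b)\<in>{(a, b). a + b = c}. of_nat (multi_binomial n c a) * f a * g b) =
        (\<Sum>(a, b)\<in>{(a, b). a + b = c}. of_nat (multi_binomial n c a) * g a * f b)"
      by (rule sum.reindex_bij_witness[of _ prod.swap prod.swap])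
        (auto simp: add.commute mult_ac, metis multi_binomial_sym)
    with True show ?thesis by (simp add: dp_mult_apply)
  qed (simp add: dp_mult_outside)
qed

lemma dp_mult_assoc:
  "dp_mult n m (dp_mult n m f g) h = dp_mult n m f (dp_mult n m g (h :: 'a::field dp))"
proof
  fix c
  show "dp_mult n m (dp_mult n m f g) h c = dp_mult n m f (dp_mult n m g h) c"
  proof (cases "c \<in> dp_indices CHAR('a) n m")
    case True
    let ?S = "\<lambda>c. {(a, b). a + b = (c :: nat \<Rightarrow> nat)}"
    have fin: "finite (?S c)" by (rule finite_splits_dp_indices[OF True])
    have fin': "finite (?S d)" "d \<in> dp_indices CHAR('a) n m"
      if "(d, e) \<in> ?S c \<or> (e, d) \<in> ?S c" for d e
    proof -
      show d: "d \<in> dp_indices CHAR('a) n m"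
        using that True by (auto dest: dp_indices_add)
      show "finite (?S d)" by (rule finite_splits_dp_indices[OF d])
    qed
    have "dp_mult n m (dp_mult n m f g) h c =
        (\<Sum>x\<in>?S c. \<Sum>y\<in>?S (fst x). of_nat (multi_binomial n c (fst x)) *
           (of_nat (multi_binomial n (fst x) (fst y)) * f (fst y) * g (snd y)) * h (snd x))"
      unfolding dp_mult_apply[OF True]
    proof (rule sum.cong[OF refl])
      fix x assume "x \<in> ?S c"
      then have "fst x \<in> dp_indices CHAR('a) n m"
        using fin'(2)[of "fst x" "snd x"] by auto
      then show "(case x of (a, b) \<Rightarrow> of_nat (multi_binomial n c a) * dp_mult n m f g a * h b) =
          (\<Sum>y\<in>?S (fst x). of_nat (multi_binomial n c (fst x)) *
            (of_nat (multi_binomial n (fst x) (fst y)) * f (fst y) * g (snd y)) * h (snd x))"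
        by (simp add: dp_mult_apply sum_distrib_left sum_distrib_right case_prod_unfold)
    qed
    also have "\<dots> = (\<Sum>(x, y)\<in>Sigma (?S c) (\<lambda>x. ?S (fst x)). of_nat (multi_binomial n c (fst x)) *
           (of_nat (multi_binomial n (fst x) (fst y)) * f (fst y) * g (snd y)) * h (snd x))"
      by (rule sum.Sigma) (use fin fin' in auto)
    \<comment> \<open>Both nested sums run over the triples with a + b + e = c; regrouping (a + b) +
      e as a + (b + e) matches them.\<close>
    also have "\<dots> = (\<Sum>(x, y)\<in>Sigma (?S c) (\<lambda>x. ?S (snd x)). of_nat (multi_binomial n c (fst x)) *
           f (fst x) * (of_nat (multi_binomial n (snd x) (fst y)) * g (fst y) * h (snd y)))"
    proof (rule sum.reindex_bij_witness[of _
        "\<lambda>((a, d), (b, e)). ((a + b, e), (a, b))" "\<lambda>((d, e), (a, b)). ((a, b + e), (b, e))"])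
      fix z assume "z \<in> Sigma (?S c) (\<lambda>x. ?S (fst x))"
      then obtain a b e where z: "z = ((a + b, e), (a, b))" and c: "c = a + b + e"
        by auto
      have "of_nat (multi_binomial n c (a + b)) * of_nat (multi_binomial n (a + b) a) =
          (of_nat (multi_binomial n c a) * of_nat (multi_binomial n (b + e) b) :: 'a)"
        unfolding c of_nat_mult[symmetric] multi_binomial_assoc ..
      then show "(case (\<lambda>((d, e), (a, b)). ((a, b + e), (b, e))) z of
           (x, y) \<Rightarrow> of_nat (multi_binomial n c (fst x)) * f (fst x) *
             (of_nat (multi_binomial n (snd x) (fst y)) * g (fst y) * h (snd y))) =
         (case z of (x, y) \<Rightarrow> of_nat (multi_binomial n c (fst x)) *
           (of_nat (multi_binomial n (fst x) (fst y)) * f (fst y) * g (snd y)) * h (snd x))"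
        unfolding z by (simp add: mult_ac)
    qed (auto simp: add.assoc)
    also have "\<dots> = (\<Sum>x\<in>?S c. \<Sum>y\<in>?S (snd x). of_nat (multi_binomial n c (fst x)) *
           f (fst x) * (of_nat (multi_binomial n (snd x) (fst y)) * g (fst y) * h (snd y)))"
      by (rule sum.Sigma[symmetric]) (use fin fin' in auto)
    also have "\<dots> = dp_mult n m f (dp_mult n m g h) c"
      unfolding dp_mult_apply[OF True]
    proof (rule sum.cong[OF refl])
      fix x assume "x \<in> ?S c"
      then have "snd x \<in> dp_indices CHAR('a) n m"
        using fin'(2)[of "snd x" "fst x"] by auto
      then show "(\<Sum>y\<in>?S (snd x). of_nat (multi_binomial n c (fst x)) * f (fst x) *
            (of_nat (multi_binomial n (snd x) (fst y)) * g (fst y) * h (snd y))) =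
          (case x of (a, b) \<Rightarrow> of_nat (multi_binomial n c a) * f a * dp_mult n m g h b)"
        by (simp add: dp_mult_apply sum_distrib_left sum_distrib_right case_prod_unfold)
    qed
    finally show ?thesis .
  qed (simp add: dp_mult_outside)
qed

lemma dp_mult_add_left: "dp_mult n m (f + f') g = dp_mult n m f g + dp_mult n m f' g"
  by (rule ext) (auto simp: dp_mult_def algebra_simps sum.distrib case_prod_unfold)

lemma dp_mult_add_right: "dp_mult n m f (g + g') = dp_mult n m f g + dp_mult n m f g'"
  by (metis dp_mult_add_left dp_mult_commute)

definition dp_scale :: "'a::field \<Rightarrow> 'a dp \<Rightarrow> 'a dp" where
  "dp_scale c f = (\<lambda>a. c * f a)"

lemma dp_mult_scale_left: "dp_mult n m (dp_scale c f) g = dp_scale c (dp_mult n m f g)"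
  by (rule ext) (auto simp: dp_mult_def dp_scale_def sum_distrib_left case_prod_unfold mult_ac)

lemma dp_mult_scale_right: "dp_mult n m f (dp_scale c g) = dp_scale c (dp_mult n m f g)"
  by (metis dp_mult_scale_left dp_mult_commute)

text \<open>Adding \<open>a\<close> and \<open>b\<close> in base \<open>p\<close> carries out of the
  lowest \<open>k\<close> digits. By Vandermonde with a + b = p^k + s the coefficient is a sum whose
  term i = 0 vanishes because s < a, while \<open>p\<close> divides (p^k choose i) for 0 < i <
  p^k.\<close>

lemma prime_dvd_choose_carry:
  fixes p :: nat
  assumes "prime p" "a < p ^ k" "b < p ^ k" "p ^ k \<le> a + b"
  shows "p dvd (a + b choose a)"
proof -
  let ?s = "a + b - p ^ k"
  have "p dvd (\<Sum>i\<le>a. (p ^ k choose i) * (?s choose (a - i)))"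
  proof (intro dvd_sum)
    fix i assume i: "i \<in> {..a}"
    show "p dvd (p ^ k choose i) * (?s choose (a - i))"
    proof (cases "i = 0")
      case True
      have "?s < a" using assms by simp
      with True show ?thesis by (simp add: binomial_eq_0)
    next
      case False
      \<comment> \<open>Since i * (p^k choose i) is a multiple of p^k, a binomial coprime to
        \<open>p\<close> would force p^k to divide \<open>i\<close>, which is too small.\<close>
      have "p dvd (p ^ k choose i)"
      proof (rule ccontr)
        assume "\<not> p dvd (p ^ k choose i)"
        then have "coprime (p ^ k) (p ^ k choose i)"
          using assms(1) by (simp add: prime_imp_coprime)
        moreover have "p ^ k dvd i * (p ^ k choose i)"
          using False by (simp add: times_binomial_minus1_eq)
        ultimately have "p ^ k dvd i"
          by (simp add: coprime_dvd_mult_left_iff)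
        then show False
          using False i assms(2) by (auto dest: dvd_imp_le)
      qed
      then show ?thesis by simp
    qed
  qed
  then show ?thesis
    using assms(4) unfolding vandermonde by simp
qed

lemma dp_mult_carrier [simp]: "dp_mult n m f g \<in> dp_carrier n m"
  by (simp add: dp_carrier_def dp_mult_def)

text \<open>For elements of the carrier the truncation in \<^const>\<open>dp_mult\<close> is automatic, as the omitted
  coefficients vanish modulo the characteristic.\<close>

lemma dp_mult_apply_carrier:
  fixes f g :: "'a::field dp"
  assumes "prime CHAR('a)" "f \<in> dp_carrier n m" "g \<in> dp_carrier n m"
  shows "dp_mult n m f g c =
    (\<Sum>(a, b)\<in>{(a, b). a + b = c}. of_nat (multi_binomial n c a) * f a * g b)"
proof (cases "c \<in> dp_indices CHAR('a) n m")
  case False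
  have "of_nat (multi_binomial n (a + b) a) * f a * g b = 0" if c: "c = a + b" for a b
  proof (cases "a \<in> dp_indices CHAR('a) n m \<and> b \<in> dp_indices CHAR('a) n m")
    case True
    \<comment> \<open>At this position the sum overflows, so the carry makes one factor of the
      multi-binomial vanish.\<close>
    then obtain i where i: "i \<in> {1..n}" "\<not> a i + b i \<le> CHAR('a) ^ m i - 1"
      using False unfolding c by (auto simp: dp_indices_def)
    have pos: "CHAR('a) ^ m i > 0" using assms(1) prime_gt_0_nat by simp
    have "a i \<le> CHAR('a) ^ m i - 1" "b i \<le> CHAR('a) ^ m i - 1"
      using True i(1) unfolding dp_indices_def by blast+
    then have "CHAR('a) dvd (a i + b i choose a i)"
      using i(2) pos by (intro prime_dvd_choose_carry[OF assms(1), of _ "m i"]) linarith+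
    also have "a i + b i choose a i = (a + b) i choose a i"
      by simp
    also have "\<dots> dvd multi_binomial n (a + b) a"
      unfolding multi_binomial_def by (rule dvd_prodI) (use i in auto)
    finally show ?thesis by (simp add: of_nat_eq_0_iff_char_dvd)
  next
    case False
    then show ?thesis using assms by (auto simp: dp_carrier_def)
  qed
  then have "(\<Sum>(a, b)\<in>{(a, b). a + b = c}. of_nat (multi_binomial n c a) * f a * g b) = 0"
    by (intro sum.neutral) auto
  then show ?thesis using False by (simp add: dp_mult_outside)
qed (rule dp_mult_apply)

text \<open>Pascal's rule in the factor \<open>j\<close>, the other factors being unchanged; this is
  the Leibniz rule on the level of coefficients.\<close>

lemma multi_binomial_pascal:
  assumes "j \<in> {1..n}"
  shows "multi_binomial n (c(j := Suc (c j))) a =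
    (if a j = 0 then 0 else multi_binomial n c (a(j := a j - 1))) + multi_binomial n c a"
proof -
  have split: "multi_binomial n c' a' = (c' j choose a' j) * (\<Prod>i\<in>{1..n} - {j}. c' i choose a' i)" for c' a'
    unfolding multi_binomial_def using assms by (simp add: prod.remove)
  have P: "(\<Prod>i\<in>{1..n} - {j}. (c(j := x)) i choose (a(j := y)) i) = (\<Prod>i\<in>{1..n} - {j}. c i choose a i)" for x y
    by (rule prod.cong) auto
  have "(Suc (c j) choose a j) = (if a j = 0 then 0 else c j choose (a j - 1)) + (c j choose a j)"
    by (cases "a j") auto
  then show ?thesis
    unfolding split[of "c(j := Suc (c j))"] split[of c] P
      P[of "Suc (c j)" "a j", unfolded fun_upd_triv] P[of "c j", unfolded fun_upd_triv]
    by (simp add: algebra_simps)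
qed

lemma dp_deriv_carrier:
  fixes f :: "'a::field dp"
  assumes "f \<in> dp_carrier n m"
  shows "dp_deriv j f \<in> dp_carrier n m"
proof -
  have "a(j := Suc (a j)) \<notin> dp_indices CHAR('a) n m" if "a \<notin> dp_indices CHAR('a) n m" for a
    using that dp_indices_le[of "a(j := Suc (a j))" _ n m a] by fastforce
  then show ?thesis using assms by (simp add: dp_carrier_def dp_deriv_def)
qed

text \<open>Pascal's rule splits the coefficient at c + \<epsilon>_j into two sums, and lowering
  \<open>a\<close> or \<open>b\<close> by \<epsilon>_j turns them into the two products. The prime
  characteristic makes the convolution formula valid also at inadmissible indices such as \<tau> +
  \<epsilon>_j.\<close>

lemma dp_deriv_mult:
  fixes f g :: "'a::field dp"
  assumes p: "prime CHAR('a)" and f: "f \<in> dp_carrier n m" and g: "g \<in> dp_carrier n m"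
    and j: "j \<in> {1..n}"
  shows "dp_deriv j (dp_mult n m f g) =
    dp_mult n m (dp_deriv j f) g + dp_mult n m f (dp_deriv j g)"
proof
  fix c
  note carr = dp_mult_apply_carrier[OF p]
  let ?u = "\<lambda>a :: nat \<Rightarrow> nat. a(j := Suc (a j))" and ?d = "\<lambda>a :: nat \<Rightarrow> nat. a(j := a j - 1)"
  let ?S = "\<lambda>c. {(a, b). a + b = (c :: nat \<Rightarrow> nat)}"
  let ?B = "\<lambda>c a. of_nat (multi_binomial n c a) :: 'a"
  show "dp_deriv j (dp_mult n m f g) c =
    (dp_mult n m (dp_deriv j f) g + dp_mult n m f (dp_deriv j g)) c"
  proof (cases "\<forall>i. i \<notin> {1..n} \<longrightarrow> c i = 0")
    case True
    have fin: "finite (?S (?u c))"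
      by (rule finite_sum_splits[of n]) (use True j in auto)
    have "dp_deriv j (dp_mult n m f g) c = (\<Sum>(a, b)\<in>?S (?u c). ?B (?u c) a * f a * g b)"
      unfolding dp_deriv_def by (rule carr[OF f g])
    also have "\<dots> = (\<Sum>(a, b)\<in>?S (?u c).
        (if a j = 0 then 0 else ?B c (?d a) * f a * g b) + ?B c a * f a * g b)"
      by (intro sum.cong refl) (auto simp: multi_binomial_pascal[OF j] algebra_simps)
    also have "\<dots> = (\<Sum>(a, b)\<in>?S (?u c). if a j = 0 then 0 else ?B c (?d a) * f a * g b) +
        (\<Sum>(a, b)\<in>?S (?u c). ?B c a * f a * g b)"
      by (simp add: sum.distrib case_prod_unfold)
    also have "(\<Sum>(a, b)\<in>?S (?u c). if a j = 0 then 0 else ?B c (?d a) * f a * g b) =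
        (\<Sum>(a, b)\<in>{(a, b)\<in>?S (?u c). a j \<noteq> 0}. ?B c (?d a) * f a * g b)"
      by (rule sum.mono_neutral_cong_right[OF fin]) (auto split: if_splits)
    also have "\<dots> = (\<Sum>(a, b)\<in>?S c. ?B c a * f (?u a) * g b)"
      by (rule sum.reindex_bij_witness[of _ "\<lambda>(a, b). (?u a, b)" "\<lambda>(a, b). (?d a, b)"])
        (auto simp: fun_eq_iff split: if_splits)
    also have "\<dots> = dp_mult n m (dp_deriv j f) g c"
      unfolding carr[OF dp_deriv_carrier[OF f] g] by (simp add: dp_deriv_def)
    \<comment> \<open>If \<open>b j = 0\<close> then \<open>a j\<close> exceeds \<open>c j\<close>
      and the binomial vanishes, so only pairs in which \<open>b\<close> can be lowered
      remain.\<close>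
    also have "(\<Sum>(a, b)\<in>?S (?u c). ?B c a * f a * g b) =
        (\<Sum>(a, b)\<in>{(a, b)\<in>?S (?u c). b j \<noteq> 0}. ?B c a * f a * g b)"
    proof (rule sum.mono_neutral_right[OF fin], blast, rule ballI)
      fix x assume "x \<in> ?S (?u c) - {(a, b) \<in> ?S (?u c). b j \<noteq> 0}"
      then obtain a b where x: "x = (a, b)" "a + b = ?u c" "b j = 0"
        by auto
      then have "a j = Suc (c j)" by (metis add_0_right fun_upd_same plus_fun_apply)
      then have "multi_binomial n c a = 0"
        unfolding multi_binomial_def using j by (intro prod_zero bexI[of _ j]) auto
      then show "(case x of (a, b) \<Rightarrow> ?B c a * f a * g b) = 0" by (simp add: x(1))
    qed
    also have "\<dots> = (\<Sum>(a, b)\<in>?S c. ?B c a * f a * g (?u b))"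
      by (rule sum.reindex_bij_witness[of _ "\<lambda>(a, b). (a, ?u b)" "\<lambda>(a, b). (a, ?d b)"])
        (auto simp: fun_eq_iff split: if_splits)
    also have "\<dots> = dp_mult n m f (dp_deriv j g) c"
      unfolding carr[OF f dp_deriv_carrier[OF g]] by (simp add: dp_deriv_def)
    finally show ?thesis by simp
  next
    case False
    then have "c \<notin> dp_indices CHAR('a) n m" "?u c \<notin> dp_indices CHAR('a) n m"
      using j by (auto simp: dp_indices_def)
    then show ?thesis by (simp add: dp_deriv_def dp_mult_outside)
  qed
qed

lemma dp_mult_monom_left:
  fixes g :: "'a::field dp"
  assumes "c \<in> dp_indices CHAR('a) n m"
  shows "dp_mult n m (dp_monom a) g c =
    (if \<forall>i. a i \<le> c i then of_nat (multi_binomial n c a) * g (c - a) else 0)"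
proof -
  have "dp_mult n m (dp_monom a) g c =
      (\<Sum>x\<in>{(a', b). a' + b = c}. if x = (a, c - a) then of_nat (multi_binomial n c a) * g (c - a) else 0)"
    unfolding dp_mult_apply[OF assms]
  proof (rule sum.cong[OF refl])
    fix x assume "x \<in> {(a', b). a' + b = c}"
    then obtain a' b where "x = (a', b)" "c = a' + b"
      by auto
    then have x: "x = (a', c - a')"
      by (auto simp: fun_eq_iff)
    show "(case x of (a', b) \<Rightarrow> of_nat (multi_binomial n c a') * dp_monom a a' * g b) =
        (if x = (a, c - a) then of_nat (multi_binomial n c a) * g (c - a) else 0)"
      unfolding x by (auto simp: dp_monom_def)
  qed
  moreover have "(a, c - a) \<in> {(a', b). a' + b = c} \<longleftrightarrow> (\<forall>i. a i \<le> c i)"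
    by (auto simp: fun_eq_iff) (metis le_add1)
  ultimately show ?thesis
    using finite_splits_dp_indices[OF assms] by simp
qed

section \<open>Linearity of products and derivatives\<close>

lemma dp_mult_diff_left: "dp_mult n m (f - f') g = dp_mult n m f g - dp_mult n m f' g"
  using dp_mult_add_left[of n m "f - f'" f' g] by simp

lemma dp_mult_sum_left: "dp_mult n m (\<Sum>i\<in>A. F i) g = (\<Sum>i\<in>A. dp_mult n m (F i) g)"
  using sum_comp_morphism[of "\<lambda>f. dp_mult n m f g" F A] by (simp add: dp_mult_add_left o_def)

lemma dp_mult_sum_right: "dp_mult n m f (\<Sum>i\<in>A. G i) = (\<Sum>i\<in>A. dp_mult n m f (G i))"
  using sum_comp_morphism[of "dp_mult n m f" G A] by (simp add: dp_mult_add_right o_def)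

lemma dp_mult_left_commute:
  "dp_mult n m f (dp_mult n m g h) = dp_mult n m g (dp_mult n m f (h :: 'a::field dp))"
  by (metis dp_mult_assoc dp_mult_commute)

lemma dp_deriv_add: "dp_deriv j (f + g) = dp_deriv j f + dp_deriv j g"
  by (simp add: dp_deriv_def fun_eq_iff)

lemma dp_deriv_scale: "dp_deriv j (dp_scale c f) = dp_scale c (dp_deriv j f)"
  by (simp add: dp_deriv_def dp_scale_def)

lemma dp_deriv_sum: "dp_deriv j (\<Sum>i\<in>A. F i) = (\<Sum>i\<in>A. dp_deriv j (F i))"
  using sum_comp_morphism[of "dp_deriv j" F A] by (simp add: dp_deriv_add o_def)

lemma dp_deriv_commute: "dp_deriv i (dp_deriv j f) = dp_deriv j (dp_deriv i f)"
  by (cases "i = j") (simp_all add: dp_deriv_def fun_upd_twist)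

lemma dp_carrier_0 [simp]: "0 \<in> dp_carrier n m"
  by (simp add: dp_carrier_def)

lemma dp_carrier_add: "f \<in> dp_carrier n m \<Longrightarrow> g \<in> dp_carrier n m \<Longrightarrow> f + g \<in> dp_carrier n m"
  by (simp add: dp_carrier_def)

lemma dp_carrier_diff: "f \<in> dp_carrier n m \<Longrightarrow> g \<in> dp_carrier n m \<Longrightarrow> f - g \<in> dp_carrier n m"
  by (simp add: dp_carrier_def)

lemma dp_carrier_scale: "f \<in> dp_carrier n m \<Longrightarrow> dp_scale c f \<in> dp_carrier n m"
  by (simp add: dp_carrier_def dp_scale_def)

lemma dp_carrier_sum: "(\<And>i. i \<in> A \<Longrightarrow> F i \<in> dp_carrier n m) \<Longrightarrow> (\<Sum>i\<in>A. F i) \<in> dp_carrier n m"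
  by (induction A rule: infinite_finite_induct) (simp_all add: dp_carrier_add)

lemma dp_scale_add: "dp_scale c (f + g) = dp_scale c f + dp_scale c g"
  by (simp add: dp_scale_def fun_eq_iff distrib_left)

lemma dp_scale_diff: "dp_scale c (f - g) = dp_scale c f - dp_scale c g"
  by (simp add: dp_scale_def fun_eq_iff right_diff_distrib)

lemma dp_scale_0 [simp]: "dp_scale c 0 = 0"
  by (simp add: dp_scale_def fun_eq_iff)

lemma dp_scale_sum: "dp_scale c (\<Sum>i\<in>A. F i) = (\<Sum>i\<in>A. dp_scale c (F i))"
  using sum_comp_morphism[of "dp_scale c" F A] by (simp add: dp_scale_add o_def)

section \<open>The Witt algebra\<close>

lemma vector_space_witt_scale: "vector_space witt_scale"
  by standard (auto simp: witt_scale_def fun_eq_iff algebra_simps)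

interpretation witt: vector_space witt_scale
  by (rule vector_space_witt_scale)

text \<open>The derivation \<open>v\<close> acting on the function \<open>g\<close>. Component
  \<open>k\<close> of a bracket is then v(w_k) - w(v_k), which reduces the Jacobi identity to
  commutators of operators.\<close>

definition witt_apply :: "nat \<Rightarrow> (nat \<Rightarrow> nat) \<Rightarrow> 'a::field derivs \<Rightarrow> 'a dp \<Rightarrow> 'a dp" where
  "witt_apply n m v g = (\<Sum>i\<in>{1..n}. dp_mult n m (v i) (dp_deriv i g))"

lemma witt_bracket_apply:
  "witt_bracket n m v w k = witt_apply n m v (w k) - witt_apply n m w (v k)"
  by (simp add: witt_bracket_def witt_apply_def sum_subtractf)

lemma witt_apply_carrier [simp]: "witt_apply n m v g \<in> dp_carrier n m"
  by (simp add: witt_apply_def dp_carrier_sum)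

lemma witt_apply_0 [simp]: "witt_apply n m v 0 = 0"
  by (simp add: witt_apply_def)

lemma witt_apply_add: "witt_apply n m v (f + g) = witt_apply n m v f + witt_apply n m v g"
  by (simp add: witt_apply_def dp_deriv_add dp_mult_add_right sum.distrib)

lemma witt_apply_diff: "witt_apply n m v (f - g) = witt_apply n m v f - witt_apply n m v g"
  using witt_apply_add[of n m v "f - g" g] by simp

lemma witt_apply_sum: "witt_apply n m v (\<Sum>i\<in>A. F i) = (\<Sum>i\<in>A. witt_apply n m v (F i))"
  using sum_comp_morphism[of "witt_apply n m v" F A] by (simp add: witt_apply_add o_def)

lemma witt_apply_scale: "witt_apply n m v (dp_scale c f) = dp_scale c (witt_apply n m v f)"
  by (simp add: witt_apply_def dp_deriv_scale dp_mult_scale_right dp_scale_sum)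

lemma witt_apply_add_left: "witt_apply n m (v + w) f = witt_apply n m v f + witt_apply n m w f"
  by (simp add: witt_apply_def dp_mult_add_left sum.distrib)

lemma witt_apply_scale_left: "witt_apply n m (witt_scale c v) f = dp_scale c (witt_apply n m v f)"
proof -
  have "witt_scale c v i = dp_scale c (v i)" for i
    by (simp add: witt_scale_def dp_scale_def)
  then show ?thesis
    by (simp add: witt_apply_def dp_mult_scale_left dp_scale_sum)
qed

lemma witt_carrierD: "v \<in> witt_carrier n m \<Longrightarrow> v i \<in> dp_carrier n m"
  by (cases "i \<in> {1..n}") (auto simp: witt_carrier_def)

lemma witt_apply_mult:
  fixes f g :: "'a::field dp"
  assumes p: "prime CHAR('a)" and f: "f \<in> dp_carrier n m" and g: "g \<in> dp_carrier n m"
  shows "witt_apply n m v (dp_mult n m f g) =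
    dp_mult n m (witt_apply n m v f) g + dp_mult n m f (witt_apply n m v g)"
proof -
  have "witt_apply n m v (dp_mult n m f g) =
      (\<Sum>i\<in>{1..n}. dp_mult n m (dp_mult n m (v i) (dp_deriv i f)) g +
        dp_mult n m f (dp_mult n m (v i) (dp_deriv i g)))"
    unfolding witt_apply_def
    by (intro sum.cong refl)
      (simp add: dp_deriv_mult[OF p f g] dp_mult_add_right dp_mult_assoc dp_mult_left_commute)
  then show ?thesis
    by (simp add: witt_apply_def sum.distrib dp_mult_sum_left dp_mult_sum_right)
qed

text \<open>v(w(g)) consists of the first-order terms v(w_i) D_i g and a second-order part
  \<open>Q\<close>. The latter is symmetric in \<open>v\<close> and \<open>w\<close> because partial
  derivatives commute, so it cancels in the commutator.\<close>

lemma witt_apply_bracket: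
  fixes g :: "'a::field dp"
  assumes p: "prime CHAR('a)" and v: "v \<in> witt_carrier n m" and w: "w \<in> witt_carrier n m"
    and g: "g \<in> dp_carrier n m"
  shows "witt_apply n m (witt_bracket n m v w) g =
    witt_apply n m v (witt_apply n m w g) - witt_apply n m w (witt_apply n m v g)"
proof -
  define Q where "Q v w = (\<Sum>i\<in>{1..n}. dp_mult n m (w i) (witt_apply n m v (dp_deriv i g)))"
    for v w :: "'a derivs"
  have compose: "witt_apply n m v (witt_apply n m w g) =
      (\<Sum>i\<in>{1..n}. dp_mult n m (witt_apply n m v (w i)) (dp_deriv i g)) + Q v w"
    if "w \<in> witt_carrier n m" for v w :: "'a derivs"
    using witt_carrierD[OF that] dp_deriv_carrier[OF g]
    by (subst witt_apply_def[of n m w])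
      (simp add: witt_apply_sum witt_apply_mult[OF p] sum.distrib Q_def)
  have "Q v w = (\<Sum>i\<in>{1..n}. \<Sum>j\<in>{1..n}. dp_mult n m (w i) (dp_mult n m (v j) (dp_deriv j (dp_deriv i g))))"
    by (simp add: Q_def witt_apply_def dp_mult_sum_right)
  also have "\<dots> = (\<Sum>j\<in>{1..n}. \<Sum>i\<in>{1..n}. dp_mult n m (v j) (dp_mult n m (w i) (dp_deriv i (dp_deriv j g))))"
    by (subst sum.swap) (simp add: dp_deriv_commute dp_mult_left_commute)
  also have "\<dots> = Q w v"
    by (simp add: Q_def witt_apply_def dp_mult_sum_right)
  finally have "Q v w = Q w v" .
  then show ?thesis
    unfolding compose[OF v] compose[OF w]
    by (simp add: witt_apply_def[of n m "witt_bracket n m v w"] witt_bracket_apply dp_mult_diff_left sum_subtractf)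
qed

text \<open>Bilinearity and [v, v] = 0 are read off the components. In the Jacobi identity,
  \<open>witt_apply_bracket\<close> turns component \<open>k\<close> into iterated actions on u_k,
  v_k and w_k, each occurring twice with opposite signs.\<close>

lemma lie_algebra_witt_subalgebra:
  fixes L :: "'a::field derivs set"
  assumes p: "prime CHAR('a)" and subspace: "witt.subspace L" and L: "L \<subseteq> witt_carrier n m"
    and closed: "\<And>v w. v \<in> L \<Longrightarrow> w \<in> L \<Longrightarrow> witt_bracket n m v w \<in> L"
  shows "lie_algebra witt_scale (witt_bracket n m) L"
proof
  fix u v w :: "'a derivs" and c :: 'a
  have scale: "witt_scale c v k = dp_scale c (v k)" for c :: 'a and v k
    by (simp add: witt_scale_def dp_scale_def)
  show "witt_bracket n m (u + v) w = witt_bracket n m u w + witt_bracket n m v w"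
    "witt_bracket n m w (u + v) = witt_bracket n m w u + witt_bracket n m w v"
    by (rule ext, simp add: witt_bracket_apply witt_apply_add_left witt_apply_add)+
  show "witt_bracket n m (witt_scale c u) v = witt_scale c (witt_bracket n m u v)"
    "witt_bracket n m u (witt_scale c v) = witt_scale c (witt_bracket n m u v)"
    by (rule ext, simp add: witt_bracket_apply scale witt_apply_scale_left witt_apply_scale dp_scale_diff)+
  show "witt_bracket n m v v = 0"
    by (rule ext) (simp add: witt_bracket_apply)
  assume "u \<in> L" "v \<in> L" "w \<in> L"
  then have uvw: "u \<in> witt_carrier n m" "v \<in> witt_carrier n m" "w \<in> witt_carrier n m"
    using L by auto
  show "witt_bracket n m u (witt_bracket n m v w) + witt_bracket n m v (witt_bracket n m w u) +
      witt_bracket n m w (witt_bracket n m u v) = 0"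
  proof
    fix k
    show "(witt_bracket n m u (witt_bracket n m v w) + witt_bracket n m v (witt_bracket n m w u) +
      witt_bracket n m w (witt_bracket n m u v)) k = 0 k"
      using uvw[THEN witt_carrierD] uvw
      by (simp add: witt_bracket_apply[of n m _ "witt_bracket n m _ _"] witt_bracket_apply[of n m _ _ k]
          witt_apply_bracket[OF p] witt_apply_diff)
  qed
qed (use subspace closed in auto)

section \<open>The top index, monomials and variables\<close>

definition dp_top :: "nat \<Rightarrow> nat \<Rightarrow> (nat \<Rightarrow> nat) \<Rightarrow> nat \<Rightarrow> nat" where
  "dp_top p n m = (\<lambda>i. if i \<in> {1..n} then p ^ m i - 1 else 0)"

lemma dp_top_in_indices [simp]: "dp_top p n m \<in> dp_indices p n m"
  by (simp add: dp_top_def dp_indices_def)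

lemma dp_indices_not_top:
  assumes "a \<in> dp_indices p n m" "a \<noteq> dp_top p n m"
  obtains j where "j \<in> {1..n}" "a(j := Suc (a j)) \<in> dp_indices p n m"
proof -
  obtain j where "a j \<noteq> dp_top p n m j"
    using assms(2) by blast
  moreover have "j \<notin> {1..n} \<Longrightarrow> a j = 0" "j \<in> {1..n} \<Longrightarrow> a j \<le> p ^ m j - 1"
    using assms(1) unfolding dp_indices_def by blast+
  ultimately have "j \<in> {1..n}" "a j < p ^ m j - 1"
    unfolding dp_top_def by (auto split: if_splits)
  with assms(1) have "a(j := Suc (a j)) \<in> dp_indices p n m"
    by (auto simp: dp_indices_def)
  then show ?thesis
    using that \<open>j \<in> {1..n}\<close> by blast
qed

lemma dp_monom_carrier: "a \<in> dp_indices CHAR('a) n m \<Longrightarrow> (dp_monom a :: 'a::field dp) \<in> dp_carrier n m"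
  by (auto simp: dp_carrier_def dp_monom_def)

text \<open>An element is the combination of the monomials in its own support. The clause
  \<open>f a \<noteq> 0\<close> lets an induction over elements without top component avoid the top
  monomial.\<close>

lemma dp_carrier_induct [consumes 1, case_names zero add scale monom]:
  fixes f :: "'a::field dp"
  assumes "f \<in> dp_carrier n m" "P 0" "\<And>f g. P f \<Longrightarrow> P g \<Longrightarrow> P (f + g)"
    "\<And>c f. P f \<Longrightarrow> P (dp_scale c f)"
    "\<And>a. a \<in> dp_indices CHAR('a) n m \<Longrightarrow> f a \<noteq> 0 \<Longrightarrow> P (dp_monom a)"
  shows "P f"
proof -
  let ?S = "{a \<in> dp_indices CHAR('a) n m. f a \<noteq> 0}"
  have fin: "finite ?S"
    by (simp add: finite_dp_indices)
  have "f = (\<Sum>a\<in>?S. dp_scale (f a) (dp_monom a))"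
  proof
    fix b
    have "(\<Sum>a\<in>?S. dp_scale (f a) (dp_monom a)) b = (\<Sum>a\<in>?S. if b = a then f a else 0)"
      unfolding sum_fun_apply by (rule sum.cong) (auto simp: dp_scale_def dp_monom_def)
    also have "\<dots> = (if b \<in> ?S then f b else 0)"
      using fin by simp
    also have "\<dots> = f b"
      using assms(1) by (auto simp: dp_carrier_def)
    finally show "f b = (\<Sum>a\<in>?S. dp_scale (f a) (dp_monom a)) b" ..
  qed
  moreover have "P (\<Sum>a\<in>B. dp_scale (f a) (dp_monom a))" if "B \<subseteq> ?S" for B
    using finite_subset[OF that fin] that
  proof (induction B rule: finite_induct)
    case empty
    show ?case unfolding sum.empty by (rule assms(2))
  next
    case (insert a B)
    then show ?case
      unfolding sum.insert[OF insert.hyps] by (intro assms(3,4)) (auto intro: assms(5))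
  qed
  ultimately show ?thesis by (metis (lifting) order_refl)
qed

definition dp_var :: "nat \<Rightarrow> 'a::field dp" where
  "dp_var k = dp_monom ((\<lambda>_. 0)(k := 1))"

lemma dp_deriv_var: "dp_deriv i (dp_var k) = (if i = k then dp_monom (\<lambda>_. 0) else 0)"
proof -
  have "(\<lambda>_. 0 :: nat)(k := 0) = (\<lambda>_. 0)"
    by auto
  then show ?thesis
    by (simp add: dp_var_def dp_deriv_monom)
qed

lemma dp_mult_one_left:
  fixes f :: "'a::field dp"
  assumes "f \<in> dp_carrier n m"
  shows "dp_mult n m (dp_monom (\<lambda>_. 0)) f = f"
proof
  fix c
  show "dp_mult n m (dp_monom (\<lambda>_. 0)) f c = f c"
  proof (cases "c \<in> dp_indices CHAR('a) n m")
    case True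
    then show ?thesis
      by (simp add: dp_mult_monom_left multi_binomial_def fun_diff_def)
  next
    case False
    then show ?thesis using assms by (simp add: dp_mult_outside dp_carrier_def)
  qed
qed

lemma dp_mult_one_right:
  "f \<in> dp_carrier n m \<Longrightarrow> dp_mult n m f (dp_monom (\<lambda>_. 0)) = f"
  by (metis dp_mult_commute dp_mult_one_left)

lemma dp_mult_var_monom:
  assumes a: "a \<in> dp_indices CHAR('a) n m" and k: "k \<in> {1..n}"
  shows "dp_mult n m (dp_var k) (dp_monom a :: 'a::field dp) =
    (if a(k := Suc (a k)) \<in> dp_indices CHAR('a) n m
     then dp_scale (of_nat (Suc (a k))) (dp_monom (a(k := Suc (a k)))) else 0)"
proof
  fix c
  let ?e = "(\<lambda>_. 0)(k := 1)"
  have "multi_binomial n c ?e = c k"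
  proof -
    have "multi_binomial n c ?e = (\<Prod>i\<in>{1..n}. if i = k then c k else 1)"
      unfolding multi_binomial_def by (rule prod.cong) auto
    then show ?thesis using k by simp
  qed
  moreover have "(\<forall>i. ?e i \<le> c i) \<and> c - ?e = a \<longleftrightarrow> c = a(k := Suc (a k))"
    by (auto simp: fun_eq_iff split: if_splits)
  ultimately have "dp_mult n m (dp_var k) (dp_monom a :: 'a dp) c =
      (if c = a(k := Suc (a k)) then of_nat (Suc (a k)) else 0)" if "c \<in> dp_indices CHAR('a) n m"
    unfolding dp_var_def dp_mult_monom_left[OF that]
    by (auto simp: dp_monom_def split: if_splits)
  then show "dp_mult n m (dp_var k) (dp_monom a :: 'a dp) c = (if a(k := Suc (a k)) \<in> dp_indices CHAR('a) n m
     then dp_scale (of_nat (Suc (a k))) (dp_monom (a(k := Suc (a k)))) else 0) c"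
    by (cases "c \<in> dp_indices CHAR('a) n m")
      (auto simp: dp_mult_outside dp_scale_def, auto simp: dp_monom_def split: if_splits)
qed

text \<open>The coefficient at \<tau> is read off at \<tau> + \<epsilon>_j, which lies outside the
  admissible range.\<close>

lemma dp_deriv_top:
  fixes f :: "'a::field dp"
  assumes "prime CHAR('a)" "f \<in> dp_carrier n m" "j \<in> {1..n}"
  shows "dp_deriv j f (dp_top CHAR('a) n m) = 0"
proof -
  have "CHAR('a) ^ m j > 0"
    using assms(1) prime_gt_0_nat by simp
  moreover have "dp_top CHAR('a) n m j = CHAR('a) ^ m j - 1"
    using assms(3) by (simp add: dp_top_def)
  ultimately have "\<not> Suc (dp_top CHAR('a) n m j) \<le> CHAR('a) ^ m j - 1"
    by linarith
  moreover have "a j \<le> CHAR('a) ^ m j - 1" if "a \<in> dp_indices CHAR('a) n m" for a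
    using that assms(3) unfolding dp_indices_def by blast
  ultimately have "(dp_top CHAR('a) n m)(j := Suc (dp_top CHAR('a) n m j)) \<notin> dp_indices CHAR('a) n m"
    by (metis fun_upd_same)
  then show ?thesis
    using assms(2) by (simp add: dp_deriv_def dp_carrier_def)
qed

section \<open>Hamiltonian fields in characteristic 2\<close>

lemma ham_dual_bounds: "i \<in> {1..2 * r} \<Longrightarrow> ham_dual r i \<in> {1..2 * r}"
  and ham_dual_dual: "i \<in> {1..2 * r} \<Longrightarrow> ham_dual r (ham_dual r i) = i"
  and ham_dual_neq: "i \<in> {1..2 * r} \<Longrightarrow> ham_dual r i \<noteq> i"
  by (auto simp: ham_dual_def)

lemma sum_ham_dual: "(\<Sum>i\<in>{1..2 * r}. F (ham_dual r i) i) = (\<Sum>i\<in>{1..2 * r}. F i (ham_dual r i))"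
  by (rule sum.reindex_bij_witness[of _ "ham_dual r" "ham_dual r"])
    (use ham_dual_bounds ham_dual_dual in auto)

lemma sum_ham_dual_pairs: "(\<Sum>i\<in>{1..2 * r}. F i) = (\<Sum>i\<in>{1..r}. F i + F (ham_dual r i))"
proof -
  have "(\<Sum>i\<in>{1..2 * r}. F i) = (\<Sum>i\<in>{1..r}. F i) + (\<Sum>i\<in>{r + 1..2 * r}. F i)"
    using sum.ub_add_nat[of 1 r F r] by (simp add: mult_2)
  also have "(\<Sum>i\<in>{r + 1..2 * r}. F i) = (\<Sum>i\<in>{1..r}. F (ham_dual r i))"
    by (rule sum.reindex_bij_witness[of _ "\<lambda>i. i + r" "\<lambda>i. i - r"]) (auto simp: ham_dual_def)
  finally show ?thesis by (simp add: sum.distrib)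
qed

lemma ham_field_add: "ham_field n (f + g) = ham_field n f + ham_field n g"
proof -
  have "witt_scale c (witt_single k (dp_deriv j (f + g))) =
      witt_scale c (witt_single k (dp_deriv j f)) + witt_scale c (witt_single k (dp_deriv j g))" for c k j
    by (auto simp: witt_scale_def witt_single_def dp_deriv_def fun_eq_iff distrib_left)
  then show ?thesis
    by (simp add: ham_field_def sum.distrib)
qed

lemma ham_field_scale: "ham_field n (dp_scale c f) = witt_scale c (ham_field n f)"
proof -
  have "witt_scale b (witt_single k (dp_deriv j (dp_scale c f))) =
      witt_scale c (witt_scale b (witt_single k (dp_deriv j f)))" for b k j
    by (auto simp: witt_scale_def witt_single_def dp_deriv_def dp_scale_def fun_eq_iff)
  then show ?thesis
    by (simp add: ham_field_def witt.scale_sum_right)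
qed

lemma ham_field_0 [simp]: "ham_field n 0 = 0"
  using ham_field_add[of n 0 0] by simp

context
  fixes n r :: nat and m :: "nat \<Rightarrow> nat"
  assumes char2: "CHAR('a::field) = 2" and n: "n = 2 * r"
    and m_pos: "\<And>i. i \<in> {1..n} \<Longrightarrow> m i > 0"
begin

lemma prime_char: "prime CHAR('a)"
  by (simp add: char2)

lemma add_self: "(x :: 'a) + x = 0"
proof -
  have "(2 :: 'a) = 0"
    using of_nat_CHAR[where 'a = 'a] by (simp add: char2)
  then show ?thesis by (simp flip: mult_2)
qed

lemma add_self_dp: "(f :: 'a dp) + f = 0"
  by (rule ext) (simp only: plus_fun_apply add_self zero_fun_apply)

lemma diff_eq_add_dp: "(f :: 'a dp) - g = f + g"
  by (simp add: diff_eq_eq add.assoc add_self_dp)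

lemma dual_bounds: "i \<in> {1..n} \<Longrightarrow> ham_dual r i \<in> {1..n}"
  and dual_dual: "i \<in> {1..n} \<Longrightarrow> ham_dual r (ham_dual r i) = i"
  and dual_neq: "i \<in> {1..n} \<Longrightarrow> ham_dual r i \<noteq> i"
  unfolding n by (fact ham_dual_bounds ham_dual_dual ham_dual_neq)+

lemma ham_field_apply:
  "ham_field n f k = (if k \<in> {1..n} then dp_deriv (ham_dual r k) (f :: 'a dp) else 0)"
proof -
  \<comment> \<open>In characteristic 2 the sign -1 equals 1.\<close>
  have sign: "ham_sign r j = (1 :: 'a)" for j
    using add_self[of 1] by (simp add: ham_sign_def eq_neg_iff_add_eq_0)
  have "ham_field n f k = (\<Sum>j\<in>{1..n}. if j = ham_dual r k \<and> k \<in> {1..n} then dp_deriv j f else 0)"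
    unfolding ham_field_def sum_fun_apply[of _ _ k]
  proof (rule sum.cong[OF refl])
    fix j assume "j \<in> {1..n}"
    then have "k = ham_dual r j \<longleftrightarrow> j = ham_dual r k \<and> k \<in> {1..n}"
      using dual_bounds dual_dual by metis
    then show "witt_scale (ham_sign (n div 2) j) (witt_single (ham_dual (n div 2) j) (dp_deriv j f)) k =
        (if j = ham_dual r k \<and> k \<in> {1..n} then dp_deriv j f else 0)"
      by (auto simp: n sign witt_scale_def witt_single_def)
  qed
  then show ?thesis
    using dual_bounds by (cases "k \<in> {1..n}") auto
qed

lemma ham_field_carrier:
  assumes "(f :: 'a dp) \<in> dp_carrier n m"
  shows "ham_field n f \<in> witt_carrier n m"
  using assms by (simp add: witt_carrier_def ham_field_apply dp_deriv_carrier)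

lemma sum_dual: "(\<Sum>i\<in>{1..n}. F (ham_dual r i) i) = (\<Sum>i\<in>{1..n}. F i (ham_dual r i))"
  unfolding n by (rule sum_ham_dual)

text \<open>{f, g} is taken as the field D_H f acting on \<open>g\<close>, so that the product rule
  for \<open>witt_apply\<close> applies in the second argument.\<close>

abbreviation (input) poisson :: "'a dp \<Rightarrow> 'a dp \<Rightarrow> 'a dp" where
  "poisson f g \<equiv> witt_apply n m (ham_field n f) g"

lemma poisson_eq:
  "poisson f g = (\<Sum>i\<in>{1..n}. dp_mult n m (dp_deriv (ham_dual r i) f) (dp_deriv i g))"
  unfolding witt_apply_def by (simp add: ham_field_apply)

text \<open>The involution taking i to i' exchanges the two factors; without signs the usual
  antisymmetry is symmetry.\<close>

lemma poisson_commute: "poisson f g = poisson g f"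
  unfolding poisson_eq using sum_dual[of "\<lambda>i j. dp_mult n m (dp_deriv i f) (dp_deriv j g)"]
  by (simp add: dp_mult_commute)

text \<open>D_k' is a derivation of the Poisson bracket, so component \<open>k\<close> on the right
  is {D_k' f, g} + {f, D_k' g}, and D_k' f and D_k' g are the components \<open>k\<close> of the two
  fields.\<close>

lemma witt_bracket_ham_field:
  assumes f: "f \<in> dp_carrier n m" and g: "g \<in> dp_carrier n m"
  shows "witt_bracket n m (ham_field n f) (ham_field n g) = ham_field n (poisson f g)"
proof
  fix k
  show "witt_bracket n m (ham_field n f) (ham_field n g) k = ham_field n (poisson f g) k"
  proof (cases "k \<in> {1..n}")
    case True
    let ?k = "ham_dual r k"
    note D = dp_deriv_carrier
    have "dp_deriv ?k (poisson f g) =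
        (\<Sum>i\<in>{1..n}. dp_mult n m (dp_deriv (ham_dual r i) (dp_deriv ?k f)) (dp_deriv i g)) +
        (\<Sum>i\<in>{1..n}. dp_mult n m (dp_deriv (ham_dual r i) f) (dp_deriv i (dp_deriv ?k g)))"
      unfolding poisson_eq dp_deriv_sum sum.distrib[symmetric]
      by (intro sum.cong refl)
        (simp add: dp_deriv_mult[OF prime_char D[OF f] D[OF g] dual_bounds[OF True]]
          dp_deriv_commute[of ?k])
    also have "\<dots> = poisson (dp_deriv ?k f) g + poisson f (dp_deriv ?k g)"
      unfolding poisson_eq ..
    finally show ?thesis
      using True by (simp add: witt_bracket_apply ham_field_apply[of _ k] diff_eq_add_dp
        poisson_commute[of g] add.commute)
  next
    case False
    then have "ham_field n h k = 0" for h :: "'a dp"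
      unfolding ham_field_apply by (rule if_not_P)
    then show ?thesis by (simp add: witt_bracket_apply)
  qed
qed

text \<open>The terms for i and i' coincide and cancel. In other words, every D_H f is
  divergence-free.\<close>

lemma sum_dual_deriv: "(\<Sum>i\<in>{1..n}. dp_deriv i (dp_deriv (ham_dual r i) (f :: 'a dp))) = 0"
  unfolding n sum_ham_dual_pairs
proof (rule sum.neutral, rule ballI)
  fix i assume "i \<in> {1..r}"
  then have "i \<in> {1..2 * r}" by auto
  then show "dp_deriv i (dp_deriv (ham_dual r i) f) +
      dp_deriv (ham_dual r i) (dp_deriv (ham_dual r (ham_dual r i)) f) = 0"
    by (simp add: ham_dual_dual dp_deriv_commute[of i] add_self_dp)
qed

text \<open>Up to a multiple of \<open>\<Sum>\<^sub>i D\<^sub>i D\<^sub>i\<^sub>' f = 0\<close> the bracket is a divergence, and derivatives have no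
  component at the top index.\<close>

lemma poisson_top:
  assumes f: "f \<in> dp_carrier n m" and g: "g \<in> dp_carrier n m"
  shows "poisson f g (dp_top CHAR('a) n m) = 0"
proof -
  let ?h = "\<lambda>i. dp_mult n m (dp_deriv (ham_dual r i) f) g"
  have "(\<Sum>i\<in>{1..n}. dp_deriv i (?h i)) =
      (\<Sum>i\<in>{1..n}. dp_mult n m (dp_deriv i (dp_deriv (ham_dual r i) f)) g) + poisson f g"
    unfolding poisson_eq sum.distrib[symmetric]
    by (intro sum.cong refl) (simp add: dp_deriv_mult[OF prime_char dp_deriv_carrier[OF f] g])
  also have "\<dots> = poisson f g"
    unfolding dp_mult_sum_left[symmetric] sum_dual_deriv by simp
  finally have "poisson f g = (\<Sum>i\<in>{1..n}. dp_deriv i (?h i))"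
    by (rule sym)
  then have "poisson f g (dp_top CHAR('a) n m) = (\<Sum>i\<in>{1..n}. dp_deriv i (?h i) (dp_top CHAR('a) n m))"
    by (simp only: sum_fun_apply)
  also have "\<dots> = 0"
    by (intro sum.neutral ballI dp_deriv_top prime_char dp_mult_carrier)
  finally show ?thesis .
qed

abbreviation (input) below_top :: "'a dp set" where
  "below_top \<equiv> {f \<in> dp_carrier n m. f (dp_top CHAR('a) n m) = 0}"

text \<open>Oddness yields both \<tau>_i \<ge> 1, so that the variables are admissible, and \<tau>_i
  = 1 in the field.\<close>

lemma odd_top: "i \<in> {1..n} \<Longrightarrow> odd (dp_top CHAR('a) n m i)"
  using m_pos[of i] by (simp add: dp_top_def char2)

lemma var_index: "k \<in> {1..n} \<Longrightarrow> (\<lambda>_. 0)(k := 1) \<in> dp_indices CHAR('a) n m"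
  by (rule dp_indices_le[OF dp_top_in_indices]) (use odd_pos[OF odd_top, of k] in auto)

lemma var_carrier: "k \<in> {1..n} \<Longrightarrow> (dp_var k :: 'a dp) \<in> dp_carrier n m"
  unfolding dp_var_def by (intro dp_monom_carrier var_index)

lemma poisson_var:
  assumes s: "s \<in> {1..n}" and f: "f \<in> dp_carrier n m"
  shows "poisson f (dp_var s) = dp_deriv (ham_dual r s) f"
proof -
  have "poisson f (dp_var s) = (\<Sum>i\<in>{1..n}. if i = s then dp_deriv (ham_dual r s) f else 0)"
    unfolding poisson_eq
    by (intro sum.cong refl) (simp add: dp_deriv_var dp_mult_one_right dp_deriv_carrier f)
  then show ?thesis using s by simp
qed

lemma poisson_var_mult:
  assumes "s \<in> {1..n}" "t \<in> {1..n}" "f \<in> dp_carrier n m"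
  shows "poisson f (dp_mult n m (dp_var s) (dp_var t)) =
    dp_mult n m (dp_var t) (dp_deriv (ham_dual r s) f) + dp_mult n m (dp_var s) (dp_deriv (ham_dual r t) f)"
  using assms by (simp add: witt_apply_mult[OF prime_char] var_carrier poisson_var dp_mult_commute)

text \<open>X^a = D_j X^(a + \<epsilon>_j) = {X^(a + \<epsilon>_j), x_j'}; this serves for
  \<open>hamiltonian_algebra\<close> and \<open>special_algebra\<close> alike.\<close>

lemma ham_field_monom:
  assumes "j \<in> {1..n}" "a(j := Suc (a j)) \<in> dp_indices CHAR('a) n m"
  shows "ham_field n (dp_monom a :: 'a dp) =
    witt_bracket n m (ham_field n (dp_monom (a(j := Suc (a j))))) (ham_field n (dp_var (ham_dual r j)))"
proof -
  have "dp_deriv j (dp_monom (a(j := Suc (a j)))) = (dp_monom a :: 'a dp)"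
    by (simp add: dp_deriv_monom)
  then show ?thesis
    using assms dp_monom_carrier[OF assms(2)] dual_bounds[of j]
    by (simp add: witt_bracket_ham_field var_carrier poisson_var dual_dual)
qed

section \<open>The Hamiltonian algebra as an image under D_H\<close>

lemma subspace_ham_field: "witt.subspace (ham_field n ` below_top)"
proof (rule witt.subspaceI)
  show "0 \<in> ham_field n ` below_top"
    by (rule image_eqI[of _ _ 0]) auto
next
  fix x y assume "x \<in> ham_field n ` below_top" "y \<in> ham_field n ` below_top"
  then obtain f g where "f \<in> below_top" "g \<in> below_top" "x = ham_field n f" "y = ham_field n g"
    by blast
  then show "x + y \<in> ham_field n ` below_top"
    by (intro image_eqI[of _ _ "f + g"]) (auto simp: ham_field_add dp_carrier_add)
next
  fix c x assume "x \<in> ham_field n ` below_top"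
  then obtain f where "f \<in> below_top" "x = ham_field n f"
    by blast
  then show "witt_scale c x \<in> ham_field n ` below_top"
    by (intro image_eqI[of _ _ "dp_scale c f"]) (auto simp: ham_field_scale dp_carrier_scale, simp add: dp_scale_def)
qed

lemma poisson_below_top:
  "f \<in> dp_carrier n m \<Longrightarrow> g \<in> dp_carrier n m \<Longrightarrow> poisson f g \<in> below_top"
  by (simp add: poisson_top)

lemma hamiltonian_algebra_eq: "hamiltonian_algebra n m = ham_field n ` below_top"
proof (rule equalityI)
  let ?G = "{witt_bracket n m x y |x y. x \<in> ham_field n ` dp_carrier n m \<and> y \<in> ham_field n ` dp_carrier n m} :: 'a derivs set"
  have H: "hamiltonian_algebra n m = witt.span ?G"
    by (simp add: hamiltonian_algebra_def derived_subalgebra_def)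
  have "?G \<subseteq> ham_field n ` below_top"
    using poisson_below_top by (auto simp: witt_bracket_ham_field)
  then show "hamiltonian_algebra n m \<subseteq> ham_field n ` below_top"
    unfolding H by (rule witt.span_minimal[OF _ subspace_ham_field])
  show "ham_field n ` below_top \<subseteq> hamiltonian_algebra n m"
  proof
    fix x assume "x \<in> ham_field n ` below_top"
    then obtain f where f: "f \<in> dp_carrier n m" "f (dp_top CHAR('a) n m) = 0" and x: "x = ham_field n f"
      by blast
    have "ham_field n f \<in> witt.span ?G"
    proof (rule dp_carrier_induct[OF f(1), where P = "\<lambda>f. ham_field n f \<in> witt.span ?G"])
      fix a assume a: "a \<in> dp_indices CHAR('a) n m" "f a \<noteq> 0"
      \<comment> \<open>\<open>f a \<noteq> 0\<close> excludes the top index, where \<open>f\<close>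
        vanishes.\<close>
      then obtain j where j: "j \<in> {1..n}" "a(j := Suc (a j)) \<in> dp_indices CHAR('a) n m"
        using f(2) by (metis dp_indices_not_top)
      then have "ham_field n (dp_monom a :: 'a dp) \<in> ?G"
        using ham_field_monom[OF j] dp_monom_carrier[OF j(2)] var_carrier[OF dual_bounds[OF j(1)]]
        by blast
      then show "ham_field n (dp_monom a) \<in> witt.span ?G" by (rule witt.span_base)
    qed (auto simp: ham_field_add ham_field_scale intro: witt.span_zero witt.span_add witt.span_scale)
    then show "x \<in> hamiltonian_algebra n m"
      by (simp add: H x)
  qed
qed

lemma lie_algebra_hamiltonian:
  "lie_algebra witt_scale (witt_bracket n m) (hamiltonian_algebra n m :: 'a derivs set)"
  unfolding hamiltonian_algebra_eq
proof (rule lie_algebra_witt_subalgebra[OF prime_char subspace_ham_field])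
  show "ham_field n ` below_top \<subseteq> witt_carrier n m"
    using ham_field_carrier by auto
next
  fix v w assume "v \<in> ham_field n ` below_top" "w \<in> ham_field n ` below_top"
  then show "witt_bracket n m v w \<in> ham_field n ` below_top"
    using poisson_below_top by (auto simp: witt_bracket_ham_field)
qed

section \<open>The special algebra for n = 2\<close>

lemma special_algebra_two:
  assumes two: "n = 2"
  shows "special_algebra n m = ham_field n ` (dp_carrier n m :: 'a dp set)"
proof (rule equalityI)
  let ?K = "{v \<in> witt_carrier n m. witt_div n v = 0} :: 'a derivs set"
  let ?G = "{witt_bracket n m v w |v w. v \<in> ?K \<and> w \<in> ?K}"
  have S: "special_algebra n m = witt.span ?G"
    by (simp add: special_algebra_def derived_subalgebra_def)
  have ivl: "{1..n} = {1, 2}" and dual: "ham_dual r 1 = 2" "ham_dual r 2 = 1"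
    using n two by (auto simp: ham_dual_def)
  \<comment> \<open>In component 1 the Leibniz rule for D_2 gives four terms. Vanishing divergence
    means D_2 v_2 = D_1 v_1 and likewise for \<open>w\<close>, which turns them into the terms of
    v(w_1) + w(v_1). Component 2 is analogous.\<close>
  have bracket: "witt_bracket n m v w = ham_field n (dp_mult n m (v 1) (w 2) + dp_mult n m (v 2) (w 1))"
    if v: "v \<in> ?K" and w: "w \<in> ?K" for v w
  proof
    fix k
    have carr: "v i \<in> dp_carrier n m" "w i \<in> dp_carrier n m" for i
      using v w by (auto intro: witt_carrierD)
    have div: "dp_deriv 2 (v 2) = dp_deriv 1 (v 1)" "dp_deriv 2 (w 2) = dp_deriv 1 (w 1)"
    proof -
      have "dp_deriv 2 (u 2) = dp_deriv 1 (u 1)" if "u \<in> ?K" for u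
      proof -
        have "dp_deriv 1 (u 1) - dp_deriv 2 (u 2) = witt_div n u"
          unfolding diff_eq_add_dp witt_div_def ivl by simp
        then show ?thesis using that by simp
      qed
      then show "dp_deriv 2 (v 2) = dp_deriv 1 (v 1)" "dp_deriv 2 (w 2) = dp_deriv 1 (w 1)"
        using v w by blast+
    qed
    have D: "dp_deriv j (dp_mult n m (v i) (w i')) =
        dp_mult n m (dp_deriv j (v i)) (w i') + dp_mult n m (v i) (dp_deriv j (w i'))"
      if "j \<in> {1, 2}" for i i' j
      using dp_deriv_mult[OF prime_char carr] that unfolding ivl by blast
    consider "k = 1" | "k = 2" | "k \<notin> {1..n}"
      using ivl by blast
    then show "witt_bracket n m v w k =
        ham_field n (dp_mult n m (v 1) (w 2) + dp_mult n m (v 2) (w 1)) k"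
    proof cases
      case 3
      then have "v k = 0" "w k = 0"
        using v w by (auto simp: witt_carrier_def)
      with 3 show ?thesis
        by (simp add: witt_bracket_apply ham_field_apply del: atLeastAtMost_iff)
    qed (simp_all add: witt_bracket_apply witt_apply_def ivl ham_field_apply dual diff_eq_add_dp
        dp_deriv_add D div dp_mult_commute[of n m "dp_deriv _ _"] add_ac del: One_nat_def)
  qed
  have ham: "ham_field n f \<in> ?K" if "f \<in> dp_carrier n m" for f
    using ham_field_carrier[OF that] sum_dual_deriv[of f] by (simp add: witt_div_def ham_field_apply)
  have subspace: "witt.subspace (ham_field n ` (dp_carrier n m :: 'a dp set))"
  proof (rule witt.subspaceI)
    show "0 \<in> ham_field n ` (dp_carrier n m :: 'a dp set)"
      by (rule image_eqI[of _ _ 0]) auto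
  qed (auto simp: ham_field_add[symmetric] ham_field_scale[symmetric] dp_carrier_add dp_carrier_scale)
  have "?G \<subseteq> ham_field n ` dp_carrier n m"
    using bracket by (auto intro!: imageI dp_carrier_add)
  then show "special_algebra n m \<subseteq> ham_field n ` (dp_carrier n m :: 'a dp set)"
    unfolding S by (rule witt.span_minimal[OF _ subspace])
  show "ham_field n ` (dp_carrier n m :: 'a dp set) \<subseteq> special_algebra n m"
  proof
    fix x assume "x \<in> ham_field n ` (dp_carrier n m :: 'a dp set)"
    then obtain f :: "'a dp" where f: "f \<in> dp_carrier n m" and x: "x = ham_field n f"
      by blast
    have "ham_field n f \<in> witt.span ?G"
    proof (rule dp_carrier_induct[OF f, where P = "\<lambda>f. ham_field n f \<in> witt.span ?G"])
      fix a assume a: "a \<in> dp_indices CHAR('a) n m" "f a \<noteq> 0"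
      show "ham_field n (dp_monom a) \<in> witt.span ?G"
      proof (cases "a = dp_top CHAR('a) n m")
        case False
        then obtain j where j: "j \<in> {1..n}" "a(j := Suc (a j)) \<in> dp_indices CHAR('a) n m"
          using a(1) by (metis dp_indices_not_top)
        then have "ham_field n (dp_monom a :: 'a dp) \<in> ?G"
          using ham_field_monom[OF j] ham[OF dp_monom_carrier[OF j(2)]]
            ham[OF var_carrier[OF dual_bounds[OF j(1)]]]
          by blast
        then show ?thesis by (rule witt.span_base)
      next
        case True
        \<comment> \<open>X^b is the top divided power of x_2 and X^c that of x_1. D_1 kills X^b and
          D_2 kills X^c, so both fields are divergence-free; the supports of \<open>?b\<close> and
          \<open>?c\<close> are disjoint, so the product has coefficient 1.\<close>
        let ?b = "(dp_top CHAR('a) n m)(1 := 0)" and ?c = "(dp_top CHAR('a) n m)(2 := 0)"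
        let ?v = "witt_single 1 (dp_monom ?b) :: 'a derivs"
          and ?w = "witt_single 2 (dp_monom ?c) :: 'a derivs"
        have idx: "?b \<in> dp_indices CHAR('a) n m" "?c \<in> dp_indices CHAR('a) n m"
          by (rule dp_indices_le[OF dp_top_in_indices], simp)+
        have "?v \<in> ?K" "?w \<in> ?K"
          using idx[THEN dp_monom_carrier] ivl
          by (auto simp: witt_carrier_def witt_single_def witt_div_def dp_deriv_monom)
        moreover have "?b + ?c = dp_top CHAR('a) n m"
          using ivl by (auto simp: fun_eq_iff dp_top_def)
        then have "dp_mult n m (dp_monom ?b) (dp_monom ?c) = (dp_monom (dp_top CHAR('a) n m) :: 'a dp)"
          using dp_mult_monom[OF idx] ivl by (simp add: multi_binomial_def)
        ultimately have "ham_field n (dp_monom a) = witt_bracket n m ?v ?w"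
          unfolding True using bracket[of ?v ?w] by (simp add: witt_single_def)
        with \<open>?v \<in> ?K\<close> \<open>?w \<in> ?K\<close> have "ham_field n (dp_monom a :: 'a dp) \<in> ?G"
          by blast
        then show ?thesis by (rule witt.span_base)
      qed
    qed (auto simp: ham_field_add ham_field_scale intro: witt.span_zero witt.span_add witt.span_scale)
    then show "x \<in> special_algebra n m"
      by (simp add: S x)
  qed
qed

section \<open>Ideals of the Hamiltonian algebra\<close>

lemma ham_field_eq_0_iff:
  "ham_field n (f :: 'a dp) = 0 \<longleftrightarrow> (\<forall>k\<in>{1..n}. dp_deriv k f = 0)"
proof
  assume "ham_field n f = 0"
  then have "ham_field n f (ham_dual r k) = 0" for k
    by simp
  then show "\<forall>k\<in>{1..n}. dp_deriv k f = 0"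
    using dual_bounds dual_dual unfolding ham_field_apply by metis
next
  assume "\<forall>k\<in>{1..n}. dp_deriv k f = 0"
  then have "ham_field n f k = 0" for k
    using dual_bounds unfolding ham_field_apply by metis
  then show "ham_field n f = 0"
    by (intro ext) (simp add: fun_eq_iff)
qed

text \<open>A nonzero index has an entry a_k > 0, and the coefficient there is one of D_k f. With
  \<open>ham_field_eq_0_iff\<close>, the condition D_H f \<noteq> 0 thus says that \<open>f\<close>
  is not constant.\<close>

lemma const_if_deriv_0:
  fixes f :: "'a dp"
  assumes f: "f \<in> dp_carrier n m" and D: "\<forall>k\<in>{1..n}. dp_deriv k f = 0"
  shows "f = dp_scale (f (\<lambda>_. 0)) (dp_monom (\<lambda>_. 0))"
proof
  fix a
  show "f a = dp_scale (f (\<lambda>_. 0)) (dp_monom (\<lambda>_. 0)) a"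
  proof (cases "a = (\<lambda>_. 0)")
    case False
    then obtain k where k: "a k \<noteq> 0"
      by auto
    have "f a = 0"
    proof (cases "a \<in> dp_indices CHAR('a) n m")
      case True
      have "k \<in> {1..n}"
      proof (rule ccontr)
        assume "k \<notin> {1..n}"
        with True have "a k = 0"
          unfolding dp_indices_def by blast
        with k show False by simp
      qed
      then have "dp_deriv k f (a(k := a k - 1)) = 0"
        using D by simp
      then show ?thesis using k by (simp add: dp_deriv_def)
    qed (use f in \<open>simp add: dp_carrier_def\<close>)
    with False show ?thesis by (simp add: dp_scale_def dp_monom_def)
  qed (simp add: dp_scale_def dp_monom_def)
qed

lemma sum_index_upd:
  assumes "k \<in> {1..n}"
  shows "(\<Sum>i\<in>{1..n}. (a(k := Suc (a k))) i) = Suc (\<Sum>i\<in>{1..n}. a i)"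
proof -
  have "(\<Sum>i\<in>{1..n} - {k}. (a(k := Suc (a k))) i) = (\<Sum>i\<in>{1..n} - {k}. a i)"
    by (rule sum.cong) auto
  then show ?thesis
    unfolding sum.remove[OF finite_atLeastAtMost assms] by simp
qed

text \<open>Differentiating as often as possible leaves a nonconstant element of degree 1.\<close>

lemma exists_linear:
  fixes J :: "'a dp set"
  assumes deriv: "\<And>f k. f \<in> J \<Longrightarrow> k \<in> {1..n} \<Longrightarrow> dp_deriv k f \<in> J"
    and "f \<in> J" "ham_field n f \<noteq> 0" "\<And>a. (\<Sum>i\<in>{1..n}. a i) > N \<Longrightarrow> f a = 0"
  shows "\<exists>g\<in>J. ham_field n g \<noteq> 0 \<and> (\<forall>k\<in>{1..n}. \<forall>j\<in>{1..n}. dp_deriv j (dp_deriv k g) = 0)"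
  using assms(2-4)
proof (induction N arbitrary: f rule: nat_less_induct)
  case (1 N)
  show ?case
  \<comment> \<open>If all first derivatives are constant, \<open>f\<close> itself is the desired
    element; otherwise some nonconstant D_k f has a smaller degree bound.\<close>
  proof (cases "\<forall>k\<in>{1..n}. ham_field n (dp_deriv k f) = 0")
    case True
    then show ?thesis
      using 1(2,3) unfolding ham_field_eq_0_iff by blast
  next
    case False
    then obtain k where k: "k \<in> {1..n}" "ham_field n (dp_deriv k f) \<noteq> 0"
      by blast
    have zero: "dp_deriv k f a = 0" if "Suc (\<Sum>i\<in>{1..n}. a i) > N" for a
      unfolding dp_deriv_def by (rule 1(4)) (use that in \<open>simp only: sum_index_upd[OF k(1)]\<close>)
    \<comment> \<open>For N = 0 every coefficient of D_k f would lie above the bound; hence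
      \<open>N - 1\<close> is a true predecessor.\<close>
    have "N \<noteq> 0"
    proof
      assume "N = 0"
      then have "dp_deriv k f = 0"
        using zero by (intro ext) simp
      then show False using k(2) by simp
    qed
    then have "N - 1 < N" "\<And>a. (\<Sum>i\<in>{1..n}. a i) > N - 1 \<Longrightarrow> dp_deriv k f a = 0"
      using zero by auto
    then show ?thesis
      using 1(1) deriv[OF 1(2) k(1)] k(2) by blast
  qed
qed

section \<open>Monomials below the top\<close>

lemma monom_below_top:
  assumes "a \<in> dp_indices CHAR('a) n m" "a \<noteq> dp_top CHAR('a) n m"
  shows "dp_monom a \<in> below_top"
  using assms by (auto simp: dp_monom_carrier) (simp add: dp_monom_def)

text \<open>The entries of \<tau> are odd, hence nonzero. A variable missing from a monomial
  therefore certifies that it is not the top one.\<close>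

lemma not_top:
  assumes "l \<in> {1..n}" "a l = 0"
  shows "a \<noteq> dp_top CHAR('a) n m"
  using odd_top[OF assms(1)] assms(2) by auto

lemma var_below_top:
  assumes "k \<in> {1..n}"
  shows "dp_var k \<in> below_top"
  unfolding dp_var_def
  using assms var_index dual_bounds[OF assms] dual_neq[OF assms]
  by (intro monom_below_top not_top[of "ham_dual r k"]) auto

lemma pair_index:
  assumes "s \<in> {1..n}" "t \<in> {1..n}"
  shows "(\<lambda>_. 0)(t := 1, s := 1) \<in> dp_indices CHAR('a) n m"
  by (rule dp_indices_le[OF dp_top_in_indices])
    (use odd_pos[OF odd_top, of s] odd_pos[OF odd_top, of t] assms in auto)

lemma var_mult_var:
  assumes "s \<in> {1..n}" "t \<in> {1..n}" "s \<noteq> t"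
  shows "dp_mult n m (dp_var s) (dp_var t) = (dp_monom ((\<lambda>_. 0)(t := 1, s := 1)) :: 'a dp)"
proof -
  have "dp_scale 1 f = f" for f :: "'a dp"
    by (simp add: dp_scale_def)
  then show ?thesis
    using dp_mult_var_monom[OF var_index assms(1), of t] pair_index[OF assms(1,2)] assms
    by (simp add: dp_var_def)
qed

text \<open>This is how the assumption on \<open>n\<close> enters: at least four indices leave one
  outside any three.\<close>

lemma exists_index:
  assumes "n > 3"
  obtains l where "l \<in> {1..n}" "l \<noteq> a" "l \<noteq> b" "l \<noteq> c"
proof -
  have "card {a, b, c} \<le> 3"
    by (simp add: card_insert_if)
  then have "\<not> {1..n} \<subseteq> {a, b, c}"
    using assms card_mono[of "{a, b, c}" "{1..n}"] by auto
  then show ?thesis using that by blast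
qed

lemma var_mult_var_below_top:
  assumes "n > 3" "s \<in> {1..n}" "t \<in> {1..n}" "s \<noteq> t"
  shows "dp_mult n m (dp_var s) (dp_var t) \<in> below_top"
proof -
  obtain l where "l \<in> {1..n}" "l \<noteq> s" "l \<noteq> t"
    using exists_index[OF assms(1), of s t t] by blast
  then show ?thesis
    unfolding var_mult_var[OF assms(2-4)]
    using pair_index[OF assms(2,3)] by (intro monom_below_top not_top[of l]) auto
qed

lemma dp_mult_scale_one: "t \<in> {1..n} \<Longrightarrow> dp_mult n m (dp_var t) (dp_scale c (dp_monom (\<lambda>_. 0))) = dp_scale c (dp_var t :: 'a dp)"
  by (simp add: dp_mult_scale_right dp_mult_one_right var_carrier)

lemma hamiltonian_ideal_full:
  fixes I :: "'a derivs set"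
  assumes n3: "n > 3" and I: "lie_ideal witt_scale (witt_bracket n m) (ham_field n ` below_top) I"
    and nonzero: "I \<noteq> {0}"
  shows "I = ham_field n ` below_top"
proof -
  let ?one = "dp_monom (\<lambda>_. 0) :: 'a dp"
  let ?x = "dp_var :: nat \<Rightarrow> 'a dp"
  let ?d = "ham_dual r"
  \<comment> \<open>The preimage of \<open>I\<close> under D_H. All further work takes place in
    \<open>J\<close>, with Poisson brackets of functions instead of brackets of fields.\<close>
  define J where "J = {f \<in> below_top. ham_field n f \<in> I}"
  have I_sub: "witt.subspace I" "I \<subseteq> ham_field n ` below_top"
    and I_bracket: "\<And>x y. x \<in> ham_field n ` below_top \<Longrightarrow> y \<in> I \<Longrightarrow> witt_bracket n m x y \<in> I"
    using I unfolding lie_ideal_def by blast+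
  have J_below: "f \<in> below_top" "f \<in> dp_carrier n m" if "f \<in> J" for f
    using that by (auto simp: J_def)
  have J_0: "0 \<in> J"
    using witt.subspace_0[OF I_sub(1)] by (simp add: J_def)
  have J_add: "f + g \<in> J" if "f \<in> J" "g \<in> J" for f g
    using that witt.subspace_add[OF I_sub(1)] by (simp add: J_def ham_field_add dp_carrier_add)
  have J_scale: "dp_scale c f \<in> J" if "f \<in> J" for c f
    using that witt.subspace_scale[OF I_sub(1)]
    by (simp add: J_def ham_field_scale dp_carrier_scale) (simp add: dp_scale_def)
  have J_unscale: "f \<in> J" if "dp_scale c f \<in> J" "c \<noteq> 0" for c f
  proof -
    have "dp_scale (1 / c) (dp_scale c f) = f"
      using that by (simp add: dp_scale_def)
    then show ?thesis using J_scale[OF that(1), of "1 / c"] by simp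
  qed
  have J_poisson: "poisson f g \<in> J" if f: "f \<in> J" and g: "g \<in> below_top" for f g
  proof -
    have "witt_bracket n m (ham_field n g) (ham_field n f) \<in> I"
      using f g by (intro I_bracket) (auto simp: J_def)
    then have "ham_field n (poisson f g) \<in> I"
      using f g by (simp add: J_def witt_bracket_ham_field poisson_commute[of f])
    then show ?thesis
      using poisson_below_top J_below(2)[OF f] g unfolding J_def by blast
  qed
  have J_deriv: "dp_deriv k f \<in> J" if f: "f \<in> J" and k: "k \<in> {1..n}" for f k
    using J_poisson[OF f var_below_top[OF dual_bounds[OF k]]]
    by (simp only: poisson_var[OF dual_bounds[OF k] J_below(2)[OF f]] dual_dual[OF k])
  \<comment> \<open>The main tool: the bracket of \<open>f\<close> with the product x_s x_t, for
    distinct s and t.\<close>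
  have J_pair: "dp_mult n m (?x t) (dp_deriv (?d s) f) + dp_mult n m (?x s) (dp_deriv (?d t) f) \<in> J"
    if f: "f \<in> J" and st: "s \<in> {1..n}" "t \<in> {1..n}" "s \<noteq> t" for f s t
    using J_poisson[OF f var_mult_var_below_top[OF n3 st]]
    by (simp only: poisson_var_mult[OF st(1,2) J_below(2)[OF f]])

  have "0 \<in> I"
    by (rule witt.subspace_0[OF I_sub(1)])
  then obtain x where "x \<in> I" "x \<noteq> 0"
    using nonzero by blast
  then obtain f where f: "f \<in> J" "ham_field n f \<noteq> 0"
    using I_sub(2) unfolding J_def by blast
  \<comment> \<open>Admissible indices have degree at most that of \<tau>, which gives the degree
    bound for \<open>exists_linear\<close>.\<close>
  have "f a = 0" if "(\<Sum>i\<in>{1..n}. a i) > (\<Sum>i\<in>{1..n}. CHAR('a) ^ m i - 1)" for a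
  proof -
    have "a \<notin> dp_indices CHAR('a) n m"
    proof
      assume "a \<in> dp_indices CHAR('a) n m"
      then have "(\<Sum>i\<in>{1..n}. a i) \<le> (\<Sum>i\<in>{1..n}. CHAR('a) ^ m i - 1)"
        unfolding dp_indices_def by (intro sum_mono) blast
      then show False using that by simp
    qed
    then show ?thesis using J_below(2)[OF f(1)] by (simp add: dp_carrier_def)
  qed
  then obtain g where g: "g \<in> J" "ham_field n g \<noteq> 0"
    and g2: "\<forall>k\<in>{1..n}. \<forall>j\<in>{1..n}. dp_deriv j (dp_deriv k g) = 0"
    using exists_linear[OF J_deriv f] by blast
  \<comment> \<open>All derivatives of \<open>g\<close> are constants; \<open>c k\<close> is the
    coefficient of x_k in \<open>g\<close>.\<close>
  define c where "c k = dp_deriv k g (\<lambda>_. 0)" for k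
  have Dg: "dp_deriv k g = dp_scale (c k) ?one" if "k \<in> {1..n}" for k
    unfolding c_def using g2 that J_below(2)[OF g(1)] by (intro const_if_deriv_0 dp_deriv_carrier) auto
  \<comment> \<open>\<open>k\<close> is the dual of an index with nonzero coefficient, since
    bracketing with a product containing x_k differentiates by D_k'.\<close>
  obtain k where k: "?d k \<in> {1..n}" "k \<in> {1..n}" "c (?d k) \<noteq> 0"
  proof -
    obtain j where j: "j \<in> {1..n}" "dp_deriv j g \<noteq> 0"
      using g(2) unfolding ham_field_eq_0_iff by blast
    then have "c j \<noteq> 0"
      using Dg[OF j(1)] by (auto simp: dp_scale_def fun_eq_iff)
    then show ?thesis
      using that[of "?d j"] j(1) dual_bounds[OF j(1)] dual_dual[OF j(1)] by simp
  qed
  \<comment> \<open>This is the bracket of \<open>g\<close> with x_k x_l, so it belongs to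
    \<open>J\<close> for l \<noteq> k.\<close>
  define y where "y l = dp_scale (c (?d k)) (?x l) + dp_scale (c (?d l)) (?x k)" for l
  have y_J: "y l \<in> J" if l: "l \<in> {1..n}" "l \<noteq> k" for l
  proof -
    have "dp_mult n m (?x l) (dp_deriv (?d k) g) + dp_mult n m (?x k) (dp_deriv (?d l) g) = y l"
      using Dg[OF dual_bounds] l k(2) by (simp add: y_def dp_mult_scale_one)
    then show ?thesis
      using J_pair[OF g(1) k(2) l(1)] l(2) by simp
  qed
  have Dy: "dp_deriv i (y l) = dp_scale (c (?d k)) (if i = l then ?one else 0) +
      dp_scale (c (?d l)) (if i = k then ?one else 0)" for i l
    by (simp only: y_def dp_deriv_add dp_deriv_scale dp_deriv_var)
  have x_J': "?x t \<in> J" if t: "t \<in> {1..n}" "t \<noteq> ?d k" for t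
  proof -
    \<comment> \<open>Bracketing y_l with x_l' x_t gives x_t D_l y_l + x_l' D_t' y_l. The second
      term vanishes because t' is neither l nor k, and the first is a nonzero multiple of
      x_t.\<close>
    obtain l where l: "l \<in> {1..n}" "l \<noteq> k" "l \<noteq> ?d t"
      using exists_index[OF n3, of k "?d t" k] by blast
    have ne: "?d l \<noteq> t" "?d t \<noteq> k" "?d t \<noteq> l"
      using l t dual_dual k by metis+
    have "dp_deriv (?d t) (y l) = 0" "dp_deriv l (y l) = dp_scale (c (?d k)) ?one"
      using ne l by (simp_all add: Dy)
    then have "dp_mult n m (?x t) (dp_deriv (?d (?d l)) (y l)) +
        dp_mult n m (?x (?d l)) (dp_deriv (?d t) (y l)) = dp_scale (c (?d k)) (?x t)"
      by (simp add: dual_dual[OF l(1)] dp_mult_scale_one[OF t(1)])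
    then have "dp_scale (c (?d k)) (?x t) \<in> J"
      using J_pair[OF y_J[OF l(1,2)] dual_bounds[OF l(1)] t(1) ne(1)] by simp
    then show ?thesis by (rule J_unscale[OF _ k(3)])
  qed
  have x_J: "?x t \<in> J" if "t \<in> {1..n}" for t
  proof (cases "t = ?d k")
    case True
    \<comment> \<open>The remaining variable x_k' is the bracket of x_s, already in
      \<open>J\<close>, with x_s' x_k'.\<close>
    obtain s where s: "s \<in> {1..n}" "s \<noteq> k" "s \<noteq> ?d k"
      using exists_index[OF n3, of k "?d k" k] by blast
    have ne: "?d s \<noteq> ?d k"
      using s dual_dual k by metis
    have "dp_mult n m (?x (?d k)) (dp_deriv (?d (?d s)) (?x s)) +
        dp_mult n m (?x (?d s)) (dp_deriv (?d (?d k)) (?x s)) = ?x (?d k)"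
      using s k by (simp add: dual_dual dp_deriv_var dp_mult_one_right var_carrier)
    then show ?thesis
      using J_pair[OF x_J'[OF s(1,3)] dual_bounds[OF s(1)] k(1) ne] True by simp
  qed (use x_J' that in blast)
  \<comment> \<open>The roles are now exchanged: the variable lies in the ideal, and
    \<open>f\<close> is an arbitrary element below the top.\<close>
  have D_J: "dp_deriv j f \<in> J" if f: "f \<in> below_top" and j: "j \<in> {1..n}" for f j
  proof -
    have "poisson f (?x (?d j)) = dp_deriv j f"
      using poisson_var[OF dual_bounds[OF j]] f dual_dual[OF j] by simp
    then show ?thesis
      using J_poisson[OF x_J[OF dual_bounds[OF j]] f] poisson_commute[of f] by simp
  qed
  have pair_J: "dp_mult n m (?x s) (?x t) \<in> J"
    if st: "s \<in> {1..n}" "t \<in> {1..n}" "s \<noteq> t" for s t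
  proof -
    let ?e = "(\<lambda>_. 0)(t := 1, s := 1) :: nat \<Rightarrow> nat"
    \<comment> \<open>x_s x_t = D_l (x_s x_t x_l), and a fourth index l' keeps the cubic monomial
      below the top.\<close>
    obtain l where l: "l \<in> {1..n}" "l \<noteq> s" "l \<noteq> t"
      using exists_index[OF n3, of s t t] by blast
    obtain l' where l': "l' \<in> {1..n}" "l' \<noteq> s" "l' \<noteq> t" "l' \<noteq> l"
      using exists_index[OF n3, of s t l] by blast
    have "?e(l := 1) \<in> dp_indices CHAR('a) n m"
      by (rule dp_indices_le[OF dp_top_in_indices])
        (use odd_pos[OF odd_top] st(1,2) l(1) in \<open>auto simp: Suc_le_eq\<close>)
    then have "dp_monom (?e(l := 1)) \<in> below_top"
      by (rule monom_below_top) (rule not_top[of l'], use l' in auto)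
    from D_J[OF this l(1)] have "dp_monom ((?e(l := 1))(l := 0)) \<in> J"
      by (simp add: dp_deriv_monom)
    moreover have "(?e(l := 1))(l := 0) = ?e"
      using l by auto
    ultimately show ?thesis
      unfolding var_mult_var[OF st] by simp
  qed
  have monom_J: "dp_monom a \<in> J"
    if a: "a \<in> dp_indices CHAR('a) n m" "a \<noteq> dp_top CHAR('a) n m" for a
  proof -
    obtain j where j: "j \<in> {1..n}" "a(j := Suc (a j)) \<in> dp_indices CHAR('a) n m"
      using a by (metis dp_indices_not_top)
    show ?thesis
    \<comment> \<open>X^a = D_j X^(a + \<epsilon>_j) settles the claim by \<open>D_J\<close> unless
      a + \<epsilon>_j = \<tau>.\<close>
    proof (cases "a(j := Suc (a j)) = dp_top CHAR('a) n m")
      case False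
      from D_J[OF monom_below_top[OF j(2) False] j(1)] show ?thesis
        by (simp add: dp_deriv_monom)
    next
      case True
      let ?T = "dp_top CHAR('a) n m"
      obtain i where i: "i \<in> {1..n}" "i \<noteq> j" "i \<noteq> ?d j"
        using exists_index[OF n3, of j "?d j" j] by blast
      have ne: "?d i \<noteq> ?d j" "?d i \<noteq> i" "?d j \<noteq> j"
        using i j(1) dual_dual dual_neq by metis+
      \<comment> \<open>For a = \<tau> - \<epsilon>_j, take b = \<tau> - \<epsilon>_i. The bracket
        of X^b with x_i x_j' is x_j' D_i' X^b + x_i D_j X^b, and the last term is \<tau>_i X^a = X^a
        as \<tau>_i is odd.\<close>
      let ?b = "?T(i := ?T i - 1)"
      have b: "?b \<in> dp_indices CHAR('a) n m"
        by (rule dp_indices_le[OF dp_top_in_indices]) auto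
      have pos: "?T l > 0" if "l \<in> {1..n}" for l
        by (rule odd_pos[OF odd_top[OF that]])
      have over: "e \<notin> dp_indices CHAR('a) n m" if "e (?d j) = Suc (?T (?d j))" for e
      proof
        assume "e \<in> dp_indices CHAR('a) n m"
        then have "e (?d j) \<le> CHAR('a) ^ m (?d j) - 1"
          using dual_bounds[OF j(1)] unfolding dp_indices_def by blast
        then show False
          using that dual_bounds[OF j(1)] by (simp add: dp_top_def)
      qed
      have one: "of_nat (?T i) = (1 :: 'a)"
      proof -
        obtain q where "?T i = 2 * q + 1"
          using odd_top[OF i(1)] by (rule oddE)
        then show ?thesis
          using of_nat_CHAR[where 'a = 'a] by (simp add: char2)
      qed
      let ?b' = "?b(j := ?b j - 1)"
      have "?b' \<in> dp_indices CHAR('a) n m"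
        by (rule dp_indices_le[OF b]) auto
      note mult = dp_mult_var_monom[OF this i(1)]
      have "?b'(i := Suc (?b' i)) = a"
      proof
        fix l
        have "?T l = (a(j := Suc (a j))) l"
          using True by simp
        then show "(?b'(i := Suc (?b' i))) l = a l"
          using pos[OF i(1)] i by auto
      qed
      moreover have "Suc (?b' i) = ?T i"
        using pos[OF i(1)] i by simp
      ultimately have "dp_mult n m (?x i) (dp_monom ?b') = (dp_monom a :: 'a dp)"
        unfolding mult using a(1) one by (simp add: dp_scale_def)
      moreover have "dp_deriv j (dp_monom ?b) = (dp_monom ?b' :: 'a dp)"
        using pos[OF j(1)] i by (subst dp_deriv_monom) simp
      ultimately have 1: "dp_mult n m (?x i) (dp_deriv j (dp_monom ?b)) = (dp_monom a :: 'a dp)"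
        by simp
      \<comment> \<open>The other term vanishes: after lowering at i', the exponent at j' is still
        maximal, so multiplying by x_j' overflows.\<close>
      let ?b'' = "?b(?d i := ?b (?d i) - 1)"
      have "?b'' \<in> dp_indices CHAR('a) n m"
        by (rule dp_indices_le[OF b]) auto
      note mult = dp_mult_var_monom[OF this dual_bounds[OF j(1)]]
      have "?b''(?d j := Suc (?b'' (?d j))) \<notin> dp_indices CHAR('a) n m"
        by (rule over) (use ne i in simp)
      then have "dp_mult n m (?x (?d j)) (dp_monom ?b'') = 0"
        unfolding mult by (rule if_not_P)
      moreover have "dp_deriv (?d i) (dp_monom ?b) = (dp_monom ?b'' :: 'a dp)"
        using pos[OF dual_bounds[OF i(1)]] ne by (subst dp_deriv_monom) simp
      ultimately have 2: "dp_mult n m (?x (?d j)) (dp_deriv (?d i) (dp_monom ?b)) = 0"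
        by simp
      have "poisson (dp_monom ?b) (dp_mult n m (?x i) (?x (?d j))) = dp_monom a"
        using 1 2 poisson_var_mult[OF i(1) dual_bounds[OF j(1)] dp_monom_carrier[OF b]]
        by (simp add: dual_dual[OF j(1)])
      moreover have "dp_monom ?b \<in> below_top"
        by (rule monom_below_top[OF b]) (use pos[OF i(1)] in \<open>auto simp: fun_eq_iff intro!: exI[of _ i]\<close>)
      ultimately show ?thesis
        using J_poisson[OF pair_J[OF i(1) dual_bounds[OF j(1)] i(3)], of "dp_monom ?b"]
        by (simp add: poisson_commute)
    qed
  qed
  have "f \<in> J" if f: "f \<in> below_top" for f
  proof (rule dp_carrier_induct[where f = f and P = "\<lambda>f. f \<in> J"])
    fix a assume "a \<in> dp_indices CHAR('a) n m" "f a \<noteq> 0"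
    with f show "dp_monom a \<in> J"
      by (intro monom_J) auto
  qed (use f J_0 J_add J_scale in auto)
  then show ?thesis
    using I_sub(2) unfolding J_def by blast
qed

section \<open>Simplicity\<close>

lemma simple_hamiltonian:
  assumes n3: "n > 3"
  shows "simple_lie_algebra witt_scale (witt_bracket n m) (hamiltonian_algebra n m :: 'a derivs set)"
proof -
  interpret lie_algebra witt_scale "witt_bracket n m" "hamiltonian_algebra n m :: 'a derivs set"
    by (rule lie_algebra_hamiltonian)
  show ?thesis
  proof
    \<comment> \<open>For noncommutativity the witness is {x_1, x_1' x_l} = x_l, where l \<noteq> 1'
      removes the second Leibniz term.\<close>
    obtain l where l: "l \<in> {1..n}" "l \<noteq> 1" "l \<noteq> ham_dual r 1"
      using exists_index[OF n3, of 1 "ham_dual r 1" 1] by blast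
    have one: "1 \<in> {1..n}" using n3 by simp
    note d = dual_bounds[OF one]
    let ?f = "dp_var 1 :: 'a dp" and ?g = "dp_mult n m (dp_var (ham_dual r 1)) (dp_var l) :: 'a dp"
    have ne: "ham_dual r l \<noteq> 1"
      using l dual_dual by metis
    have "poisson ?f ?g = dp_var l"
      using ne by (simp add: poisson_var_mult[OF d l(1) var_carrier[OF one]] dual_dual[OF one]
          dp_deriv_var dp_mult_one_right[OF var_carrier[OF l(1)]] del: One_nat_def)
    moreover have "ham_field n (dp_var l :: 'a dp) \<noteq> 0"
    proof -
      have "(dp_monom (\<lambda>_. 0) :: 'a dp) \<noteq> 0"
        by (auto simp: dp_monom_def fun_eq_iff)
      then show ?thesis
        using l(1) unfolding ham_field_eq_0_iff by (auto simp: dp_deriv_var)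
    qed
    moreover have "?f \<in> below_top" "?g \<in> below_top"
      using var_below_top[OF one] var_mult_var_below_top[OF n3 d l(1)] l(3) by auto
    ultimately show "\<exists>x\<in>hamiltonian_algebra n m. \<exists>y\<in>hamiltonian_algebra n m. witt_bracket n m x y \<noteq> (0 :: 'a derivs)"
      unfolding hamiltonian_algebra_eq
      by (intro bexI[of _ "ham_field n ?f"] bexI[of _ "ham_field n ?g"]) (auto simp: witt_bracket_ham_field)
  next
    fix I :: "'a derivs set"
    assume "lie_ideal witt_scale (witt_bracket n m) (hamiltonian_algebra n m) I"
    then show "I = {0} \<or> I = hamiltonian_algebra n m"
      using hamiltonian_ideal_full[OF n3] unfolding hamiltonian_algebra_eq by blast
  qed
qed

end

theorem theorem4:
  fixes n r :: nat and m :: "nat \<Rightarrow> nat"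
    and H :: "'a::field derivs set"
  assumes "CHAR('a) = 2"
    and "r \<ge> 1" and "n = 2 * r"
    and "\<And>i. i \<in> {1..n} \<Longrightarrow> m i > 0"
    and "n = 2 \<Longrightarrow> (m 1, m 2) \<noteq> (1, 1)"
    and "H = hamiltonian_algebra n m"
  shows "(n > 2 \<longrightarrow> simple_lie_algebra witt_scale (witt_bracket n m) H) \<and>
    (n = 2 \<longrightarrow>
       lie_isomorphic
         witt_scale (witt_bracket n m) H
         witt_scale (witt_bracket 2 m)
           (derived_subalgebra witt_scale (witt_bracket 2 m)
             (special_algebra 2 m :: 'a derivs set)))"
proof (intro conjI impI)
  assume "n > 2"
  \<comment> \<open>\<open>n\<close> is even.\<close>
  then have "n > 3" using assms(3) by presburger
  then show "simple_lie_algebra witt_scale (witt_bracket n m) H"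
    using simple_hamiltonian[OF assms(1,3,4)] assms(6) by simp
next
  assume two: "n = 2"
  \<comment> \<open>S(2,m) is the full image of D_H, whose derived subalgebra is H by definition;
    the isomorphism is the identity.\<close>
  have "derived_subalgebra witt_scale (witt_bracket 2 m) (special_algebra 2 m) = H"
    using special_algebra_two[OF assms(1,3,4) two] two assms(6) by (simp add: hamiltonian_algebra_def)
  moreover have "lie_algebra witt_scale (witt_bracket 2 m) H"
    using lie_algebra_hamiltonian[OF assms(1,3,4)] two assms(6) by simp
  ultimately show "lie_isomorphic witt_scale (witt_bracket n m) H witt_scale (witt_bracket 2 m)
      (derived_subalgebra witt_scale (witt_bracket 2 m) (special_algebra 2 m))"
    unfolding lie_isomorphic_def two by (auto intro!: exI[of _ id])
qed

end
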